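(* Let $G\in\mathbb{G}$, and let $\pi$ be an initial distribution on $\Sigma$. When $0<\zeta<1$, under $\mathbb{P}^{G,\zeta}_\pi$, $$\mathbf{Z}_n\ \longrightarrow\ \nu_G$$ in probability as $n\to\infty$; when more specifically $0<\zeta<1/2$, this convergence is $\mathbb{P}^{G,\zeta}_\pi$-almost sure. When $\zeta>1$, under $\mathbb{P}^{G,\zeta}_\pi$, $$\mathbf{Z}_n\ \stackrel{d}{\longrightarrow}\ \sum_{i=1}^m \nu_{G,\pi,\zeta}(i)\,\delta_{\mathbf{i}}.$$
   Context: Let $\Sigma=\{1,\ldots,m\}$ with $m\ge 2$. $\mathbb{G}$ is the set of real $m\times m$ matrices $G$ with $G(i,j)>0$ for all distinct $i,j$ and $G(i,i)=-\sum_{j\ne i}G(i,j)$ (so $G(i,i)<0$). For $G\in\mathbb{G}$ and $\zeta>0$ put $n(G,\zeta)=\lceil \max_{1\le i\le m}|G(i,i)|^{1/\zeta}\rceil$ and define stochastic matrices $P^{G,\zeta}_n=I$ for $1\le n\le n(G,\zeta)$ and $P^{G,\zeta}_n=I+G/n^\zeta$ for $n\ge n(G,\zeta)+1$. For a distribution $\pi$ on $\Sigma$, $\mathbb{P}^{G,\zeta}_\pi$ is the law on $\Sigma^{\{0,1,2,\ldots\}}$ of the time-nonhomogeneous Markov chain $(X_n)_{n\ge 0}$ (coordinate process) with initial distribution $\pi$ and $\mathbb{P}^{G,\zeta}_\pi(X_{n+1}=j\mid X_0,\ldots,X_{n-1},X_n=i)=P^{G,\zeta}_{n+1}(i,j)$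 for $n\ge 0$. The occupation vector is $\mathbf{Z}_n=\langle Z_{1,n},\ldots,Z_{m,n}\rangle$, $Z_{i,n}=\frac1n\sum_{k=1}^n 1_i(X_k)$, $n\ge1$ ($1_i$ is the indicator of state $i$), which takes values in the simplex $\Delta_m=\{\mathbf{x}\in[0,1]^m:\sum_i x_i=1\}$. $\nu_G$ is the unique left eigenvector of $G$ for eigenvalue $0$ with positive entries summing to $1$. $\nu_{G,\pi,\zeta}$ denotes the probability vector on $\Sigma$ which is the limit in distribution of $X_n$ under $\mathbb{P}^{G,\zeta}_\pi$ as $n\to\infty$ (this limit exists). $\mathbf{i}\in\Delta_m$ is the standard basis vector with $1$ in the $i$th component, and $\delta_{\mathbf{i}}$ is the point mass at $\mathbf{i}$. *)

theory Defs
  imports "HOL-Probability.Probability"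
begin

text \<open>The state space is the finite type \<^typ>\<open>'m\<close>; real \<open>m \<times> m\<close> matrices have type
  \<^typ>\<open>real ^ 'm ^ 'm\<close>, with \<open>G $ i $ j\<close> for the entry \<open>G(i,j)\<close>.\<close>

definition generators :: "(real ^ 'm ^ 'm) set" where
  "generators = {G. (\<forall>i j. i \<noteq> j \<longrightarrow> G $ i $ j > 0) \<and>
                    (\<forall>i. G $ i $ i = - (\<Sum>j\<in>UNIV - {i}. G $ i $ j))}"

definition threshold :: "real ^ 'm ^ 'm \<Rightarrow> real \<Rightarrow> nat" where
  "threshold G \<zeta> = nat \<lceil>Max (range (\<lambda>i. \<bar>G $ i $ i\<bar> powr (1 / \<zeta>)))\<rceil>"

definition transition :: "real ^ 'm ^ 'm \<Rightarrow> real \<Rightarrow> nat \<Rightarrow> real ^ 'm ^ 'm" where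
  "transition G \<zeta> n =
     (if n \<le> threshold G \<zeta> then mat 1 else mat 1 + (1 / real n powr \<zeta>) *\<^sub>R G)"

text \<open>\<open>P n\<close> governs the step from time \<open>n - 1\<close> to time \<open>n\<close>; \<open>P 0\<close> plays no role. The conditional
  probabilities are prescribed only on histories of positive probability.\<close>

definition is_markov_law ::
  "'m::finite pmf \<Rightarrow> (nat \<Rightarrow> real ^ 'm ^ 'm) \<Rightarrow> (nat \<Rightarrow> 'm) measure \<Rightarrow> bool" where
  "is_markov_law \<pi> P M \<longleftrightarrow>
     prob_space M \<and>
     sets M = sets (PiM UNIV (\<lambda>_. count_space UNIV)) \<and>
     (\<forall>i. \<P>(\<omega> in M. \<omega> 0 = i) = pmf \<pi> i) \<and>
     (\<forall>n x j. \<P>(\<omega> in M. \<forall>k\<le>n. \<omega> k = x k) > 0 \<longrightarrow>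
        \<P>(\<omega> in M. \<omega> (Suc n) = j \<bar> \<forall>k\<le>n. \<omega> k = x k) = P (Suc n) $ x n $ j)"

text \<open>Existence and uniqueness of this law are proved in \<open>is_markov_law_chain_law\<close> below.\<close>

definition chain_law ::
  "real ^ 'm ^ 'm \<Rightarrow> real \<Rightarrow> 'm::finite pmf \<Rightarrow> (nat \<Rightarrow> 'm) measure" where
  "chain_law G \<zeta> \<pi> = (THE M. is_markov_law \<pi> (transition G \<zeta>) M)"

text \<open>Time \<open>0\<close> is not counted.\<close>

definition occupation :: "nat \<Rightarrow> (nat \<Rightarrow> 'm) \<Rightarrow> real ^ 'm" where
  "occupation n \<omega> = (\<chi> i. (1 / real n) * (\<Sum>k=1..n. indicator {i} (\<omega> k)))"

definition stationary_vector :: "real ^ 'm ^ 'm \<Rightarrow> real ^ 'm" where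
  "stationary_vector G =
     (THE v. v v* G = 0 \<and> (\<forall>i. v $ i > 0) \<and> (\<Sum>i\<in>UNIV. v $ i) = 1)"

definition tendsto_in_prob ::
  "'a measure \<Rightarrow> (nat \<Rightarrow> 'a \<Rightarrow> 'b::metric_space) \<Rightarrow> ('a \<Rightarrow> 'b) \<Rightarrow> bool" where
  "tendsto_in_prob M X Y \<longleftrightarrow>
     (\<forall>\<epsilon>>0. (\<lambda>n. \<P>(\<omega> in M. dist (X n \<omega>) (Y \<omega>) > \<epsilon>)) \<longlonglongrightarrow> 0)"

text \<open>Weak convergence of probability measures on a topological space. The explicit topology
  allows one notion to serve both for the discrete state space and for \<open>\<real>\<^sup>m\<close>.\<close>

definition weakly_converges ::
  "'a topology \<Rightarrow> (nat \<Rightarrow> 'a measure) \<Rightarrow> 'a measure \<Rightarrow> bool" where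
  "weakly_converges T \<mu> \<nu> \<longleftrightarrow>
     (\<forall>f. continuous_map T euclideanreal f \<and> bounded (f ` topspace T) \<longrightarrow>
        (\<lambda>n. \<integral>x. f x \<partial>\<mu> n) \<longlonglongrightarrow> (\<integral>x. f x \<partial>\<nu>))"

definition limit_distribution ::
  "real ^ 'm ^ 'm \<Rightarrow> real \<Rightarrow> 'm::finite pmf \<Rightarrow> 'm pmf" where
  "limit_distribution G \<zeta> \<pi> =
     (THE \<nu>. weakly_converges (discrete_topology UNIV)
        (\<lambda>n. distr (chain_law G \<zeta> \<pi>) (count_space UNIV) (\<lambda>\<omega>. \<omega> n)) (measure_pmf \<nu>))"

text \<open>The mixture \<open>\<Sum>i. \<nu>(i) \<delta>\<^sub>i\<close> of the point masses at the standard basis vectors,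
  see \<open>emeasure_vertex_mixture\<close>.\<close>

definition vertex_mixture :: "'m::finite pmf \<Rightarrow> (real ^ 'm) measure" where
  "vertex_mixture \<nu> = measure_pmf \<nu> \<bind> (\<lambda>i. return borel (axis i 1))"

lemma emeasure_vertex_mixture:
  fixes \<nu> :: "'m::finite pmf"
  assumes "A \<in> sets borel"
  shows "emeasure (vertex_mixture \<nu>) A =
    (\<Sum>i\<in>UNIV. ennreal (pmf \<nu> i) * emeasure (return borel (axis i 1)) A)"
proof -
  have "emeasure (vertex_mixture \<nu>) A =
      (\<integral>\<^sup>+i. emeasure (return borel (axis i (1::real))) A \<partial>measure_pmf \<nu>)"
    unfolding vertex_mixture_def
    by (rule emeasure_bind[where N=borel])
       (use assms in \<open>auto simp: space_subprob_algebra intro!: prob_space_imp_subprob_space prob_space_return\<close>)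
  also have "\<dots> = (\<Sum>i\<in>UNIV. emeasure (return borel (axis i (1::real))) A * ennreal (pmf \<nu> i))"
    by (rule nn_integral_measure_pmf_support) (auto simp: set_pmf_eq)
  finally show ?thesis by (simp add: mult.commute)
qed

lemma weakly_converges_discrete_unique:
  fixes \<nu> \<nu>' :: "'m::finite pmf"
  assumes "weakly_converges (discrete_topology UNIV) \<mu> (measure_pmf \<nu>)"
    and "weakly_converges (discrete_topology UNIV) \<mu> (measure_pmf \<nu>')"
  shows "\<nu> = \<nu>'"
proof (rule pmf_eqI)
  fix i
  have c: "continuous_map (discrete_topology UNIV) euclideanreal (indicator {i})"
    and b: "bounded ((indicator {i} :: 'm \<Rightarrow> real) ` topspace (discrete_topology UNIV))"
    by (auto intro!: finite_imp_bounded)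
  have "(\<integral>x. indicator {i} x \<partial>measure_pmf \<nu>) = (\<integral>x. indicator {i} x \<partial>measure_pmf \<nu>' :: real)"
    using assms c b unfolding weakly_converges_def by (blast intro: LIMSEQ_unique)
  then show "pmf \<nu> i = pmf \<nu>' i" by (simp add: pmf.rep_eq)
qed

lemma row_sum_transition:
  assumes "G \<in> generators"
  shows "(\<Sum>j\<in>UNIV. transition G \<zeta> n $ i $ j) = 1"
proof -
  have "(\<Sum>j\<in>UNIV. G $ i $ j) = G $ i $ i + (\<Sum>j\<in>UNIV - {i}. G $ i $ j)"
    by (simp add: sum.remove)
  then have "(\<Sum>j\<in>UNIV. G $ i $ j) = 0"
    using assms by (simp add: generators_def)
  then show ?thesis
    by (auto simp: transition_def mat_def sum.distrib sum_divide_distrib[symmetric])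
qed

lemma transition_nonneg:
  fixes G :: "real ^ 'm ^ 'm"
  assumes G: "G \<in> generators" and \<zeta>: "\<zeta> > 0"
  shows "transition G \<zeta> n $ i $ j \<ge> 0"
proof (cases "n \<le> threshold G \<zeta>")
  case False
  have "\<bar>G $ i $ i\<bar> powr (1 / \<zeta>) \<le> Max (range (\<lambda>i. \<bar>G $ i $ i\<bar> powr (1 / \<zeta>)))"
    by (rule Max_ge) auto
  also have "\<dots> \<le> real n"
    using False unfolding threshold_def by linarith
  finally have "(\<bar>G $ i $ i\<bar> powr (1 / \<zeta>)) powr \<zeta> \<le> real n powr \<zeta>"
    by (intro powr_mono2) (use \<zeta> in auto)
  then have "\<bar>G $ i $ i\<bar> \<le> real n powr \<zeta>"
    using \<zeta> by (simp add: powr_powr)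
  moreover have "real n powr \<zeta> > 0" using False by simp
  ultimately have "- 1 \<le> G $ i $ i / real n powr \<zeta>"
    by (simp add: field_simps abs_if split: if_splits)
  then show ?thesis
    using False G by (auto simp: transition_def mat_def generators_def less_imp_le)
qed (simp add: transition_def mat_def)

lemma measurable_eq_coordinate [measurable]:
  "{\<omega> \<in> space (PiM UNIV (\<lambda>_. count_space UNIV)). \<forall>k\<le>n. \<omega> k = (x k :: 'm::countable)}
     \<in> sets (PiM UNIV (\<lambda>_::nat. count_space UNIV))"
  by measurable

lemma is_markov_law_cylinder:
  assumes "is_markov_law \<pi> P M"
  shows "\<P>(\<omega> in M. \<forall>k\<le>n. \<omega> k = x k) = pmf \<pi> (x 0) * (\<Prod>k<n. P (Suc k) $ x k $ x (Suc k))"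
proof (induction n)
  case 0
  then show ?case using assms by (simp add: is_markov_law_def)
next
  case (Suc n)
  interpret prob_space M using assms by (simp add: is_markov_law_def)
  have sM: "sets M = sets (PiM UNIV (\<lambda>_. count_space UNIV))"
    using assms by (simp add: is_markov_law_def)
  note [measurable_cong] = sM
  have sp: "space M = UNIV" using sets_eq_imp_space_eq[OF sM] by (simp add: space_PiM)
  let ?A = "\<lambda>n. {\<omega> \<in> space M. \<forall>k\<le>n. \<omega> k = x k}"
  have meas: "?A n \<in> sets M" for n by measurable
  have eq: "?A (Suc n) = {\<omega> \<in> space M. \<omega> (Suc n) = x (Suc n) \<and> (\<forall>k\<le>n. \<omega> k = x k)}"
    by (auto simp: le_Suc_eq)
  show ?case
  proof (cases "prob (?A n) > 0")
    case True
    then have "\<P>(\<omega> in M. \<omega> (Suc n) = x (Suc n) \<bar> \<forall>k\<le>n. \<omega> k = x k)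
        = P (Suc n) $ x n $ x (Suc n)"
      using assms unfolding is_markov_law_def by blast
    then have "prob (?A (Suc n)) = P (Suc n) $ x n $ x (Suc n) * prob (?A n)"
      using True unfolding cond_prob_def eq by (simp add: field_simps)
    then show ?thesis using Suc by (simp add: mult.assoc mult.left_commute mult.commute)
  next
    case False
    then have 0: "prob (?A n) = 0" by (simp add: zero_less_measure_iff)
    have "prob (?A (Suc n)) \<le> prob (?A n)"
      by (rule finite_measure_mono[OF _ meas]) auto
    then have "prob (?A (Suc n)) = 0" using 0 by (simp add: order_antisym)
    then show ?thesis using Suc 0 by auto
  qed
qed

lemma is_markov_law_unique:
  fixes M N :: "(nat \<Rightarrow> 'm::finite) measure"
  assumes M: "is_markov_law \<pi> P M" and N: "is_markov_law \<pi> P N"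
  shows "M = N"
proof -
  let ?U = "\<lambda>_::nat. count_space (UNIV :: 'm set)"
  have D: "distr M (PiM {..n} ?U) (\<lambda>\<omega>. restrict \<omega> {..n}) =
      distr N (PiM {..n} ?U) (\<lambda>\<omega>. restrict \<omega> {..n})" for n
  proof -
    have s: "PiM {..n} ?U = count_space (PiE {..n} (\<lambda>_. UNIV))"
      by (rule count_space_PiM_finite) auto
    have e: "emeasure (distr L (PiM {..n} ?U) (\<lambda>\<omega>. restrict \<omega> {..n})) {a} =
        ennreal (pmf \<pi> (a 0) * (\<Prod>k<n. P (Suc k) $ a k $ a (Suc k)))"
      if L: "is_markov_law \<pi> P L" and a: "a \<in> PiE {..n} (\<lambda>_. UNIV)" for L a
    proof -
      interpret L: prob_space L using L by (simp add: is_markov_law_def)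
      have sL[measurable_cong]: "sets L = sets (PiM UNIV ?U)"
        using L by (simp add: is_markov_law_def)
      have m: "(\<lambda>\<omega>. restrict \<omega> {..n}) \<in> measurable L (PiM {..n} ?U)"
        by (rule measurable_restrict) measurable
      have "(\<lambda>\<omega>. restrict \<omega> {..n}) -` {a} \<inter> space L = {\<omega> \<in> space L. \<forall>k\<le>n. \<omega> k = a k}"
        using a by (auto simp: fun_eq_iff restrict_def PiE_def extensional_def)
      then have "emeasure (distr L (PiM {..n} ?U) (\<lambda>\<omega>. restrict \<omega> {..n})) {a} =
          emeasure L {\<omega> \<in> space L. \<forall>k\<le>n. \<omega> k = a k}"
        using a by (subst emeasure_distr[OF m]) (auto simp: s)
      then show ?thesis
        using is_markov_law_cylinder[OF L, of n a] by (simp add: L.emeasure_eq_measure)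
    qed
    show ?thesis
      by (rule measure_eqI_finite[where A="PiE {..n} (\<lambda>_. UNIV)"])
         (auto simp: s e[OF M, unfolded s] e[OF N, unfolded s] intro!: finite_PiE)
  qed
  have emb: "emeasure L (prod_emb UNIV ?U J (Pi\<^sub>E J F)) =
      emeasure (distr L (PiM {..n} ?U) (\<lambda>\<omega>. restrict \<omega> {..n})) (prod_emb {..n} ?U J (Pi\<^sub>E J F))"
    if L: "is_markov_law \<pi> P L" and J: "finite J" "J \<subseteq> {..n}" for L J F n
  proof -
    have sL: "sets L = sets (PiM UNIV ?U)" using L by (simp add: is_markov_law_def)
    have sp: "space L = UNIV" using sets_eq_imp_space_eq[OF sL] by (simp add: space_PiM)
    have "(\<lambda>\<omega>. restrict \<omega> {..n}) \<in> measurable (PiM UNIV ?U) (PiM {..n} ?U)"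
      by (rule measurable_restrict) measurable
    then have m: "(\<lambda>\<omega>. restrict \<omega> {..n}) \<in> measurable L (PiM {..n} ?U)"
      using sL by (simp cong: measurable_cong_sets)
    have "prod_emb UNIV ?U J (Pi\<^sub>E J F) =
        (\<lambda>\<omega>. restrict \<omega> {..n}) -` prod_emb {..n} ?U J (Pi\<^sub>E J F) \<inter> space L"
      using J by (auto simp: sp prod_emb_def PiE_iff) (metis atMost_iff subsetD)
    then show ?thesis
      using J by (subst emeasure_distr[OF m]) (auto intro!: sets_PiM_I)
  qed
  show ?thesis
  proof (rule measure_eqI_PiM_infinite[where I=UNIV and M="?U"])
    show "sets M = sets (PiM UNIV ?U)" "sets N = sets (PiM UNIV ?U)"
      using M N by (auto simp: is_markov_law_def)
    show "finite_measure M"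
      using M by (auto simp: is_markov_law_def prob_space_def)
    fix J :: "nat set" and F assume J: "finite J"
    then obtain n where "J \<subseteq> {..n}" using finite_nat_iff_bounded_le by blast
    then show "emeasure M (prod_emb UNIV ?U J (Pi\<^sub>E J F)) = emeasure N (prod_emb UNIV ?U J (Pi\<^sub>E J F))"
      using emb[OF M J] emb[OF N J] D[of n] by simp
  qed
qed

lemma is_markov_law_exists:
  fixes P :: "nat \<Rightarrow> real ^ 'm::finite ^ 'm"
  assumes nonneg: "\<And>n i j. P n $ i $ j \<ge> 0" and sum1: "\<And>n i. (\<Sum>j\<in>UNIV. P n $ i $ j) = 1"
  shows "\<exists>M. is_markov_law \<pi> P M"
proof -
  define row where "row n i = embed_pmf (\<lambda>j. P n $ i $ j)" for n i
  have pmf_row: "pmf (row n i) j = P n $ i $ j" for n i j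
    unfolding row_def
    by (rule pmf_embed_pmf) (auto simp: nonneg sum1 nn_integral_count_space_finite)
  define K where "K n \<omega> = measure_pmf (case n of 0 \<Rightarrow> \<pi> | Suc k \<Rightarrow> row n (\<omega> k))"
    for n and \<omega> :: "nat \<Rightarrow> 'm"
  let ?U = "\<lambda>_::nat. count_space (UNIV :: 'm set)"
  have fs: "PiM {0..<n} ?U = count_space (PiE {0..<n} (\<lambda>_. UNIV))" for n
    by (rule count_space_PiM_finite) auto
  interpret Ionescu_Tulcea K ?U
  proof (rule Ionescu_Tulcea.intro)
    show "K i \<in> measurable (PiM {0..<i} ?U) (subprob_algebra (count_space UNIV))" for i
      unfolding fs
      by (auto simp: K_def space_subprob_algebra
               intro!: prob_space_imp_subprob_space measure_pmf.prob_space_axioms)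
    show "prob_space (K i x)" if "x \<in> space (PiM {0..<i} ?U)" for i x
      unfolding K_def by (rule measure_pmf.prob_space_axioms)
  qed
  define L where "L = PF.lim"
  have sL: "sets L = sets (PiM UNIV ?U)" unfolding L_def by simp
  have sp: "space L = UNIV" using sets_eq_imp_space_eq[OF sL] by (simp add: space_PiM)
  have cyl: "emeasure L {\<omega> \<in> space L. \<forall>k<n. \<omega> k = x k} = C 0 n (\<lambda>_. undefined) {restrict x {0..<n}}"
    for n x
  proof -
    have X: "{restrict x {0..<n}} \<in> sets (PiM {0..<n} ?U)" by (simp add: fs)
    have "{\<omega> \<in> space L. \<forall>k<n. \<omega> k = x k} = PF.emb UNIV {0..<n} {restrict x {0..<n}}"
      by (auto simp: sp prod_emb_def fun_eq_iff restrict_def) metis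
    then have "emeasure L {\<omega> \<in> space L. \<forall>k<n. \<omega> k = x k} = emeasure (CI {0..<n}) {restrict x {0..<n}}"
      using lim[OF _ X] by (simp add: L_def)
    also have "\<dots> = C 0 n (\<lambda>_. undefined) (PF.emb {0..<n} {0..<n} {restrict x {0..<n}})"
      by (rule emeasure_CI) (auto simp: X)
    also have "PF.emb {0..<n} {0..<n} {restrict x {0..<n}} = {restrict x {0..<n}}"
      by (rule prod_emb_id) auto
    finally show ?thesis .
  qed
  have step: "emeasure L {\<omega> \<in> space L. \<forall>k<Suc n. \<omega> k = x k} =
      emeasure L {\<omega> \<in> space L. \<forall>k<n. \<omega> k = x k} * emeasure (K n x) {x n}" for n x
  proof -
    have u: "(\<lambda>_. undefined) \<in> space (PiM {0..<0} ?U)" by (simp add: space_PiM)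
    have sC: "sets (C 0 n (\<lambda>_. undefined)) = Pow (PiE {0..<n} (\<lambda>_. UNIV))"
      using sets_C[OF u, of n] by (simp add: fs)
    have spC: "space (C 0 n (\<lambda>_. undefined)) = PiE {0..<n} (\<lambda>_. UNIV)"
      using space_C[OF u, of n] by (simp add: fs)
    have X: "{restrict x {0..<Suc n}} \<in> sets (PiM {0..<Suc n} ?U)" by (simp add: fs)
    have mE: "eP n \<in> measurable (C 0 n (\<lambda>_. undefined)) (subprob_algebra (PiM {0..<Suc n} ?U))"
      using measurable_eP[of n] sets_C[OF u, of n] by (simp cong: measurable_cong_sets)
    have "C 0 (Suc n) (\<lambda>_. undefined) {restrict x {0..<Suc n}} =
        (\<integral>\<^sup>+\<omega>. eP n \<omega> {restrict x {0..<Suc n}} \<partial>C 0 n (\<lambda>_. undefined))"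
      using mE X by (simp, subst emeasure_bind[where N="PiM {0..<Suc n} ?U"]) (auto simp: spC PiE_eq_empty_iff)
    also have "\<dots> = (\<integral>\<^sup>+\<omega>. emeasure (K n x) {x n} * indicator {restrict x {0..<n}} \<omega> \<partial>C 0 n (\<lambda>_. undefined))"
    proof (rule nn_integral_cong)
      fix \<omega> assume "\<omega> \<in> space (C 0 n (\<lambda>_. undefined))"
      then have w: "\<omega> \<in> space (PiM {0..<n} ?U)" and w': "\<omega> \<in> PiE {0..<n} (\<lambda>_. UNIV)"
        by (auto simp: spC fs)
      have "eP n \<omega> {restrict x {0..<Suc n}} =
          K n \<omega> ((\<lambda>y. fun_upd \<omega> n y) -` {restrict x {0..<Suc n}} \<inter> space (count_space UNIV))"
        by (rule emeasure_eP[OF w X])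
      also have "(\<lambda>y. fun_upd \<omega> n y) -` {restrict x {0..<Suc n}} \<inter> space (count_space UNIV) =
          (if \<omega> = restrict x {0..<n} then {x n} else {})"
      proof -
        have "fun_upd \<omega> n y = restrict x {0..<Suc n} \<longleftrightarrow> y = x n \<and> \<omega> = restrict x {0..<n}" for y
        proof
          assume *: "fun_upd \<omega> n y = restrict x {0..<Suc n}"
          from fun_cong[OF this, of n] have "y = x n" by simp
          moreover have "\<omega> k = restrict x {0..<n} k" for k
            using fun_cong[OF *, of k] w' by (cases "k < n") (auto simp: PiE_def extensional_def)
          ultimately show "y = x n \<and> \<omega> = restrict x {0..<n}" by auto
        qed (auto simp: fun_eq_iff restrict_def)
        then show ?thesis by auto
      qed
      finally have e: "eP n \<omega> {restrict x {0..<Suc n}} =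
          K n \<omega> (if \<omega> = restrict x {0..<n} then {x n} else {})" .
      have Kx: "K n (restrict x {0..<n}) = K n x"
        by (simp add: K_def split: nat.splits)
      show "eP n \<omega> {restrict x {0..<Suc n}} =
          emeasure (K n x) {x n} * indicator {restrict x {0..<n}} \<omega>"
        unfolding e using Kx by (cases "\<omega> = restrict x {0..<n}") (simp_all only: if_True if_False, simp_all)
    qed
    also have "\<dots> = emeasure (K n x) {x n} * C 0 n (\<lambda>_. undefined) {restrict x {0..<n}}"
      by (rule nn_integral_cmult_indicator) (simp add: sC)
    finally show ?thesis by (simp only: cyl mult.commute)
  qed
  have PL: "prob_space L"
    by (rule prob_spaceI) (use cyl[of 0 undefined] in \<open>simp add: fs[of 0, simplified] restrict_def\<close>)
  interpret L: prob_space L by (rule PL)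
  have stepr: "L.prob {\<omega> \<in> space L. \<forall>k\<le>n. \<omega> k = x k} =
      L.prob {\<omega> \<in> space L. \<forall>k<n. \<omega> k = x k} * measure (K n x) {x n}" for n x
    using step[of n x] by (simp add: measure_def enn2real_mult less_Suc_eq_le)
  have "is_markov_law \<pi> P L"
    unfolding is_markov_law_def
  proof (intro conjI allI impI)
    show "prob_space L" by fact
    show "sets L = sets (PiM UNIV ?U)" by fact
    show "\<P>(\<omega> in L. \<omega> 0 = i) = pmf \<pi> i" for i
      using stepr[of 0 "\<lambda>_. i"] L.prob_space by (simp add: K_def pmf.rep_eq)
    fix n x j
    assume pos: "\<P>(\<omega> in L. \<forall>k\<le>n. \<omega> k = x k) > 0"
    let ?x = "fun_upd x (Suc n) j"
    have 1: "{\<omega> \<in> space L. \<forall>k\<le>Suc n. \<omega> k = ?x k} =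
        {\<omega> \<in> space L. \<omega> (Suc n) = j \<and> (\<forall>k\<le>n. \<omega> k = x k)}"
      by (auto simp: le_Suc_eq)
    have 2: "{\<omega> \<in> space L. \<forall>k<Suc n. \<omega> k = ?x k} = {\<omega> \<in> space L. \<forall>k\<le>n. \<omega> k = x k}"
      by (auto simp: less_Suc_eq_le)
    show "\<P>(\<omega> in L. \<omega> (Suc n) = j \<bar> \<forall>k\<le>n. \<omega> k = x k) = P (Suc n) $ x n $ j"
      using stepr[of "Suc n" ?x] pos unfolding cond_prob_def 1 2
      by (simp add: K_def pmf_row[symmetric] pmf.rep_eq)
  qed
  then show ?thesis by blast
qed

theorem is_markov_law_chain_law:
  assumes "G \<in> generators" "\<zeta> > 0"
  shows "is_markov_law \<pi> (transition G \<zeta>) (chain_law G \<zeta> \<pi>)"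
proof -
  have "\<exists>M. is_markov_law \<pi> (transition G \<zeta>) M"
    by (rule is_markov_law_exists) (use assms in \<open>auto simp: transition_nonneg row_sum_transition\<close>)
  then show ?thesis
    unfolding chain_law_def using is_markov_law_unique by (metis (no_types, lifting) theI)
qed

end

theory Submission
  imports Defs "HOL-Library.Discrete_Functions" "HOL-Real_Asymp.Real_Asymp"
begin

text \<open>For \<open>\<zeta> < 1\<close> everything follows from \<open>E \<bar>Z\<^sub>n - \<nu>\<^sub>G\<bar>\<^sup>2 = O(n\<^sup>\<zeta>\<^sup>-\<^sup>1)\<close>. On vectors of coordinate
  sum \<open>0\<close> the map \<open>z \<mapsto> z G\<close> is injective, so \<open>\<bar>Z\<^sub>n - \<nu>\<^sub>G\<bar>\<close> is at most a constant times
  \<open>\<bar>Z\<^sub>n G\<bar>\<close>. Since \<open>G = k\<^sup>\<zeta> (P\<^sub>k - I)\<close> for large \<open>k\<close>, the vector \<open>n Z\<^sub>n G\<close> is, up to a bounded error, a sum of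
  \<open>k\<^sup>\<zeta>\<close> times increments of state indicators, which is \<open>O(n\<^sup>\<zeta>)\<close> by summation by parts, minus a
  martingale. A jump at time \<open>k\<close> has probability \<open>O(k\<^sup>-\<^sup>\<zeta>)\<close>, so the variance of this martingale is
  \<open>O(n\<^sup>1\<^sup>+\<^sup>\<zeta>)\<close>. Along \<open>n = j\<^sup>2\<close> the bounds are summable exactly when \<open>\<zeta> < 1/2\<close>; monotonicity of
  the occupation counts fills the gaps between consecutive squares. For \<open>\<zeta> > 1\<close> the jump
  probabilities are summable, so by Borel-Cantelli almost every path is eventually constant.\<close>

section \<open>Left null vectors of a generator and the stationary vector\<close>

lemma row_sum_generator:
  assumes "G \<in> generators"
  shows "(\<Sum>j\<in>UNIV. G $ i $ j) = 0"
  using assms by (simp add: generators_def sum.remove[of UNIV i])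

lemma generator_offdiag_nonneg:
  assumes "G \<in> generators" "i \<noteq> j"
  shows "G $ i $ j \<ge> 0"
  using assms by (auto simp: generators_def intro: less_imp_le)

text \<open>If \<open>w $ j = 0\<close>, the \<open>j\<close>th equation of
  \<open>w v* G = 0\<close> only involves the terms \<open>G $ i $ j * w $ i\<close> with
  \<open>i \<noteq> j\<close>. They are nonnegative with strictly positive coefficients, so every
  \<open>w $ i\<close> vanishes.\<close>

lemma left_null_nonneg_imp_pos:
  fixes G :: "real ^ 'm::finite ^ 'm"
  assumes G: "G \<in> generators" and w: "w v* G = 0" "\<And>i. w $ i \<ge> 0" "w \<noteq> 0"
  shows "w $ j > 0"
proof (rule ccontr)
  assume "\<not> w $ j > 0"
  with w(2)[of j] have j: "w $ j = 0" by simp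
  have "(\<Sum>i\<in>UNIV. G $ i $ j * w $ i) = 0"
    using w(1) by (simp add: vector_matrix_mult_def vec_eq_iff mult.commute)
  then have "(\<Sum>i\<in>UNIV - {j}. G $ i $ j * w $ i) = 0"
    by (simp add: sum.remove[of UNIV j] j)
  then have "\<forall>i\<in>UNIV - {j}. G $ i $ j * w $ i = 0"
    by (subst (asm) sum_nonneg_eq_0_iff) (auto simp: w(2) generator_offdiag_nonneg[OF G])
  moreover have "G $ i $ j > 0" if "i \<noteq> j" for i
    using G that by (simp add: generators_def)
  ultimately have "w $ i = 0" for i
    using j by (metis DiffI UNIV_I empty_iff insert_iff less_irrefl mult_eq_0_iff)
  then show False using w(3) by (simp add: vec_eq_iff)
qed

text \<open>Off the diagonal \<open>G\<close> is nonnegative, so the triangle inequality gives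
  \<open>(\<bar>u\<bar> G)\<^sub>j \<ge> 0\<close> for every \<open>j\<close>; as the rows of \<open>G\<close> sum to \<open>0\<close>, these numbers add up to \<open>0\<close>.\<close>

lemma left_null_abs:
  fixes G :: "real ^ 'm::finite ^ 'm"
  assumes G: "G \<in> generators" and u: "u v* G = 0"
  shows "(\<chi> i. \<bar>u $ i\<bar>) v* G = 0"
proof -
  let ?s = "\<lambda>j. \<Sum>i\<in>UNIV. G $ i $ j * \<bar>u $ i\<bar>"
  have nonneg: "?s j \<ge> 0" for j
  proof -
    have "(\<Sum>i\<in>UNIV. G $ i $ j * u $ i) = 0"
      using u by (simp add: vector_matrix_mult_def vec_eq_iff mult.commute)
    then have "G $ j $ j * u $ j = - (\<Sum>i\<in>UNIV - {j}. G $ i $ j * u $ i)"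
      by (simp add: sum.remove[of UNIV j])
    then have "\<bar>G $ j $ j * u $ j\<bar> \<le> (\<Sum>i\<in>UNIV - {j}. G $ i $ j * \<bar>u $ i\<bar>)"
      using sum_abs[of "\<lambda>i. G $ i $ j * u $ i" "UNIV - {j}"]
      by (simp add: abs_mult generator_offdiag_nonneg[OF G])
    moreover have "G $ j $ j \<le> 0"
    proof -
      have "(\<Sum>k\<in>UNIV - {j}. G $ j $ k) \<ge> 0"
        by (intro sum_nonneg generator_offdiag_nonneg[OF G]) auto
      moreover have "G $ j $ j = - (\<Sum>k\<in>UNIV - {j}. G $ j $ k)"
        using G unfolding generators_def by blast
      ultimately show ?thesis by simp
    qed
    ultimately show ?thesis by (simp add: sum.remove[of UNIV j] abs_mult)
  qed
  have "(\<Sum>j\<in>UNIV. ?s j) = (\<Sum>i\<in>UNIV. (\<Sum>j\<in>UNIV. G $ i $ j) * \<bar>u $ i\<bar>)"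
    by (subst sum.swap) (simp add: sum_distrib_right)
  then have "(\<Sum>j\<in>UNIV. ?s j) = 0" by (simp add: row_sum_generator[OF G])
  then have "?s j = 0" for j using nonneg by (simp add: sum_nonneg_eq_0_iff)
  then show ?thesis by (simp add: vector_matrix_mult_def vec_eq_iff mult.commute)
qed

lemma vector_matrix_add_rdistrib: "(x + y) v* A = x v* A + y v* (A :: real ^ 'n ^ 'm::finite)"
  by (simp add: vector_matrix_mult_def vec_eq_iff algebra_simps sum.distrib)

text \<open>By \<open>left_null_abs\<close>, twice the positive part of \<open>u\<close> is again a
  null vector. If it is nonzero, it is positive everywhere, hence so is \<open>u\<close>, and the
  sum cannot be 0. This gives both uniqueness of the stationary vector and injectivity of
  \<open>z \<mapsto> z v* G\<close> on sum-zero vectors.\<close>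

lemma left_null_sum_zero:
  fixes G :: "real ^ 'm::finite ^ 'm"
  assumes G: "G \<in> generators" and u: "u v* G = 0" "(\<Sum>i\<in>UNIV. u $ i) = 0"
  shows "u = 0"
proof (rule ccontr)
  assume "u \<noteq> 0"
  define w where "w = (\<chi> i. \<bar>u $ i\<bar>) + u"
  have wG: "w v* G = 0"
    unfolding w_def by (simp add: vector_matrix_add_rdistrib left_null_abs[OF G u(1)] u(1))
  have w0: "w $ i \<ge> 0" for i by (simp add: w_def)
  have "\<exists>i. u $ i > 0"
  proof (rule ccontr)
    assume "\<nexists>i. u $ i > 0"
    then have "\<forall>i. - u $ i \<ge> 0" by (auto simp: not_less)
    then have "\<forall>i. - u $ i = 0"
      using u(2) sum_nonneg_eq_0_iff[of UNIV "\<lambda>i. - u $ i"] by (simp add: sum_negf)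
    with \<open>u \<noteq> 0\<close> show False by (simp add: vec_eq_iff)
  qed
  then obtain i where "u $ i > 0" by blast
  then have "w $ i \<noteq> 0" by (simp add: w_def)
  then have "w \<noteq> 0" by auto
  have wpos: "w $ j > 0" for j
    by (rule left_null_nonneg_imp_pos[OF G wG w0 \<open>w \<noteq> 0\<close>])
  have "u $ j > 0" for j using wpos[of j] by (auto simp: w_def abs_if split: if_splits)
  then have "(\<Sum>j\<in>UNIV. u $ j) > 0" by (intro sum_pos) auto
  with u(2) show False by simp
qed

text \<open>\<open>G\<close> annihilates the all-ones vector, so it is singular and, being square,
  has a nonzero left null vector too. Its absolute values form a positive null vector, which is
  normalised. Two candidates differ by a null vector of sum 0, so the definite description is well
  defined.\<close>

lemma stationary_vector_props:
  fixes G :: "real ^ 'm::finite ^ 'm"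
  assumes G: "G \<in> generators"
  shows "stationary_vector G v* G = 0" "(\<Sum>i\<in>UNIV. stationary_vector G $ i) = 1"
proof -
  let ?S = "\<lambda>v. v v* G = 0 \<and> (\<forall>i. v $ i > 0) \<and> (\<Sum>i\<in>UNIV. v $ i) = 1"
  have "G *v 1 = 0"
    by (simp add: matrix_vector_mult_def vec_eq_iff row_sum_generator[OF G])
  moreover have "(1 :: real ^ 'm) \<noteq> 0" by simp
  ultimately have "\<nexists>B. B ** G = mat 1" using matrix_left_invertible_ker[of G] by blast
  then have "\<nexists>B. B ** transpose G = mat 1"
    using left_invertible_transpose[of G] matrix_left_right_inverse[of G] by auto
  then obtain u where u: "transpose G *v u = 0" "u \<noteq> 0"
    using matrix_left_invertible_ker by blast
  define w where "w = (\<chi> i. \<bar>u $ i\<bar>)"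
  have wG: "w v* G = 0" using left_null_abs[OF G] u(1) by (simp add: w_def)
  have w0: "w $ i \<ge> 0" for i by (simp add: w_def)
  have "w \<noteq> 0" using u(2) by (simp add: w_def vec_eq_iff)
  then have wpos: "w $ i > 0" for i by (rule left_null_nonneg_imp_pos[OF G wG w0])
  define s where "s = (\<Sum>i\<in>UNIV. w $ i)"
  have s: "s > 0" unfolding s_def using wpos by (intro sum_pos) auto
  have "?S ((1 / s) *\<^sub>R w)"
  proof (intro conjI allI)
    have "(1 / s) *\<^sub>R w v* G = (1 / s) *\<^sub>R (w v* G)"
      by (simp add: vector_matrix_mult_def vec_eq_iff sum_divide_distrib)
    then show "(1 / s) *\<^sub>R w v* G = 0" by (simp add: wG)
    show "((1 / s) *\<^sub>R w) $ i > 0" for i using s wpos by simp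
    have "(\<Sum>i\<in>UNIV. ((1 / s) *\<^sub>R w) $ i) = (\<Sum>i\<in>UNIV. w $ i) / s"
      by (simp add: sum_divide_distrib)
    then show "(\<Sum>i\<in>UNIV. ((1 / s) *\<^sub>R w) $ i) = 1"
      using s by (simp add: s_def[symmetric])
  qed
  moreover have "v = v'" if "?S v" "?S v'" for v v'
  proof -
    have "(v - v') v* G = v v* G - v' v* G"
      by (simp add: vector_matrix_mult_def vec_eq_iff left_diff_distrib sum_subtractf)
    then have "(v - v') v* G = 0" using that by simp
    moreover have "(\<Sum>i\<in>UNIV. (v - v') $ i) = 0" using that by (simp add: sum_subtractf)
    ultimately have "v - v' = 0" by (rule left_null_sum_zero[OF G])
    then show ?thesis by simp
  qed
  ultimately have "\<exists>!v. ?S v" by (intro ex1I[of ?S "(1 / s) *\<^sub>R w"])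
  then have "?S (stationary_vector G)" unfolding stationary_vector_def by (rule theI')
  then show "stationary_vector G v* G = 0" "(\<Sum>i\<in>UNIV. stationary_vector G $ i) = 1" by auto
qed

text \<open>An injective linear map on a finite-dimensional space is bounded below. This is applied
  to the difference of \<open>z\<close> and the stationary vector, which has sum 0 and the same
  image as \<open>z\<close>.\<close>

lemma dist_stationary_vector_le:
  fixes G :: "real ^ 'm::finite ^ 'm"
  assumes G: "G \<in> generators"
  obtains e where "e > 0"
    "\<And>z. (\<Sum>i\<in>UNIV. z $ i) = 1 \<Longrightarrow> e * dist z (stationary_vector G) \<le> norm (z v* G)"
proof -
  let ?V = "{x :: real ^ 'm. (\<Sum>i\<in>UNIV. x $ i) = 0}"
  have sub: "subspace ?V"
    by (auto simp: subspace_def sum.distrib sum_distrib_left[symmetric])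
  have lin: "linear (\<lambda>x. x v* G)"
    by (rule linearI) (simp_all add: vector_matrix_mult_def vec_eq_iff algebra_simps sum.distrib sum_distrib_left)
  have "\<exists>e>0. \<forall>x\<in>?V. norm (x v* G) \<ge> e * norm x"
    by (rule injective_imp_isometric)
      (use sub lin left_null_sum_zero[OF G] in \<open>auto simp: closed_subspace linear_conv_bounded_linear\<close>)
  then obtain e where e: "e > 0" "\<And>x. x \<in> ?V \<Longrightarrow> e * norm x \<le> norm (x v* G)" by blast
  show thesis
  proof
    show "e > 0" by fact
    fix z :: "real ^ 'm" assume z: "(\<Sum>i\<in>UNIV. z $ i) = 1"
    have "z - stationary_vector G \<in> ?V"
      using z stationary_vector_props(2)[OF G] by (simp add: sum_subtractf)
    then have "e * norm (z - stationary_vector G) \<le> norm ((z - stationary_vector G) v* G)"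
      by (rule e)
    also have "(z - stationary_vector G) v* G = z v* G"
      using linear_diff[OF lin, of z "stationary_vector G"] stationary_vector_props(1)[OF G] by simp
    finally show "e * dist z (stationary_vector G) \<le> norm (z v* G)" by (simp add: dist_norm)
  qed
qed

section \<open>Limits of averages of real sequences\<close>

lemma eventually_const_imp_average_tendsto:
  fixes a :: "nat \<Rightarrow> real"
  assumes "\<forall>\<^sub>F n in sequentially. a n = l"
  shows "(\<lambda>n. (1 / real n) * (\<Sum>k=1..n. a k)) \<longlonglongrightarrow> l"
proof -
  obtain N where N: "\<And>n. n \<ge> N \<Longrightarrow> a n = l"
    using assms by (auto simp: eventually_sequentially)
  \<comment> \<open>The binder reaches over the difference: \<open>K\<close> is the total deviation
    from \<open>l\<close>, to which indices beyond \<open>N\<close> contribute nothing.\<close>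
  define K where "K = (\<Sum>k=1..N. a k - l)"
  have "(\<lambda>n. l + K / real n) \<longlonglongrightarrow> l"
    by real_asymp
  moreover have "\<forall>\<^sub>F n in sequentially. l + K / real n = (1 / real n) * (\<Sum>k=1..n. a k)"
    using eventually_ge_at_top[of "Suc N"]
  proof eventually_elim
    case (elim n)
    have "(\<Sum>k=1..n. a k - l) = K"
      using elim unfolding K_def by (intro sum.mono_neutral_right) (auto simp: N)
    then show ?case using elim by (simp add: sum_subtractf field_simps)
  qed
  ultimately show ?thesis by (rule Lim_transform_eventually)
qed

text \<open>A nondecreasing sequence at \<open>n\<close> is squeezed between its values at the squares around \<open>n\<close>.\<close>

lemma average_tendsto_along_squares:
  fixes S :: "nat \<Rightarrow> real"
  assumes mono: "mono S" and nonneg: "\<And>n. S n \<ge> 0"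
    and lim: "(\<lambda>j. S (j\<^sup>2) / real (j\<^sup>2)) \<longlonglongrightarrow> l"
  shows "(\<lambda>n. S n / real n) \<longlonglongrightarrow> l"
proof -
  \<comment> \<open>After cancellation these are \<open>S (j\<^sup>2) / (j+1)\<^sup>2\<close> and
    \<open>S ((j+1)\<^sup>2) / j\<^sup>2\<close>. They are written as an average at a square times a
    ratio tending to 1, so that both limits can be read off.\<close>
  define lo where "lo j = S (j\<^sup>2) / real (j\<^sup>2) * (real (j\<^sup>2) / real ((Suc j)\<^sup>2))" for j :: nat
  define hi where "hi j = S ((Suc j)\<^sup>2) / real ((Suc j)\<^sup>2) * (real ((Suc j)\<^sup>2) / real (j\<^sup>2))" for j :: nat
  have "(\<lambda>j::nat. real (j\<^sup>2) / real ((Suc j)\<^sup>2)) \<longlonglongrightarrow> 1"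
    unfolding of_nat_power of_nat_Suc by real_asymp
  from tendsto_mult[OF lim this] have lo: "lo \<longlonglongrightarrow> l" unfolding lo_def by simp
  have "(\<lambda>j::nat. real ((Suc j)\<^sup>2) / real (j\<^sup>2)) \<longlonglongrightarrow> 1"
    unfolding of_nat_power of_nat_Suc by real_asymp
  from tendsto_mult[OF LIMSEQ_Suc[OF lim] this] have hi: "hi \<longlonglongrightarrow> l" unfolding hi_def by simp
  have sq: "filterlim floor_sqrt at_top sequentially"
    unfolding filterlim_at_top eventually_sequentially by (meson le_floor_sqrtI)
  show ?thesis
  proof (rule tendsto_sandwich)
    show "(\<lambda>n. lo (floor_sqrt n)) \<longlonglongrightarrow> l" using lo sq by (rule filterlim_compose)
    show "(\<lambda>n. hi (floor_sqrt n)) \<longlonglongrightarrow> l" using hi sq by (rule filterlim_compose)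
    have *: "S ((floor_sqrt n)\<^sup>2) \<le> S n" "S n \<le> S ((Suc (floor_sqrt n))\<^sup>2)" for n
      using mono Suc_floor_sqrt_power2_gt[of n] by (auto simp: mono_def less_imp_le)
    show "\<forall>\<^sub>F n in sequentially. lo (floor_sqrt n) \<le> S n / real n"
      using eventually_gt_at_top[of 0]
    proof eventually_elim
      case (elim n)
      then have "lo (floor_sqrt n) = S ((floor_sqrt n)\<^sup>2) / real ((Suc (floor_sqrt n))\<^sup>2)"
        by (simp add: lo_def)
      also have "\<dots> \<le> S n / real n"
      proof (rule frac_le)
        have "real n \<le> real ((Suc (floor_sqrt n))\<^sup>2)"
          unfolding of_nat_le_iff using Suc_floor_sqrt_power2_gt[of n] by simp
        then show "real n \<le> real ((Suc (floor_sqrt n))\<^sup>2)" .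
      qed (use * nonneg elim in auto)
      finally show ?case .
    qed
    show "\<forall>\<^sub>F n in sequentially. S n / real n \<le> hi (floor_sqrt n)"
      using eventually_gt_at_top[of 0]
    proof eventually_elim
      case (elim n)
      have "S n / real n \<le> S ((Suc (floor_sqrt n))\<^sup>2) / real ((floor_sqrt n)\<^sup>2)"
      proof (rule frac_le)
        show "real ((floor_sqrt n)\<^sup>2) \<le> real n"
          unfolding of_nat_le_iff by simp
      qed (use * nonneg elim in auto)
      also have "\<dots> = hi (floor_sqrt n)"
        by (simp add: hi_def del: power_Suc of_nat_Suc)
      finally show ?case .
    qed
  qed
qed

section \<open>Martingale differences and jumps of a time-nonhomogeneous chain\<close>

locale markov_chain =
  fixes \<pi> :: "'m::finite pmf" and P :: "nat \<Rightarrow> real ^ 'm ^ 'm" and M :: "(nat \<Rightarrow> 'm) measure"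
  assumes law: "is_markov_law \<pi> P M"
begin

sublocale prob_space M
  using law by (simp add: is_markov_law_def)

lemma sets_M [measurable_cong]: "sets M = sets (PiM UNIV (\<lambda>_. count_space UNIV))"
  using law by (simp add: is_markov_law_def)

lemma space_M [simp]: "space M = UNIV"
  using sets_eq_imp_space_eq[OF sets_M] by (simp add: space_PiM)

text \<open>Derived from the product formula for cylinders, so that it also covers histories of
  probability 0, where the defining conditional probabilities say nothing.\<close>

lemma prob_cylinder_Suc:
  "prob {\<omega>. (\<forall>k\<le>n. \<omega> k = x k) \<and> \<omega> (Suc n) = j} =
   prob {\<omega>. \<forall>k\<le>n. \<omega> k = x k} * P (Suc n) $ x n $ j"
proof -
  have "{\<omega>. (\<forall>k\<le>n. \<omega> k = x k) \<and> \<omega> (Suc n) = j} = {\<omega>. \<forall>k\<le>Suc n. \<omega> k = (x(Suc n := j)) k}"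
    by (auto simp: le_Suc_eq)
  then show ?thesis
    using is_markov_law_cylinder[OF law, of "Suc n" "x(Suc n := j)"]
      is_markov_law_cylinder[OF law, of n x] by simp
qed

text \<open>As the state space is finite, a function of the coordinates up to \<open>n\<close> is a
  finite combination of cylinder indicators, hence measurable and bounded. The second claim is the
  Markov property summed over these cylinders; it replaces conditional expectations.\<close>

lemma
  fixes F :: "(nat \<Rightarrow> 'm) \<Rightarrow> real"
  assumes F: "\<And>\<omega> \<omega>'. (\<And>k. k \<le> n \<Longrightarrow> \<omega> k = \<omega>' k) \<Longrightarrow> F \<omega> = F \<omega>'"
  shows integrable_history: "integrable M F"
    and expectation_history_increment:
      "expectation (\<lambda>\<omega>. F \<omega> * (indicator {j} (\<omega> (Suc n)) - P (Suc n) $ \<omega> n $ j)) = 0"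
proof -
  define A where "A = PiE {..n} (\<lambda>_. UNIV :: 'm set)"
  define C where "C a = {\<omega>. \<forall>k\<le>n. \<omega> k = a k}" for a :: "nat \<Rightarrow> 'm"
  define D where "D a = {\<omega>. (\<forall>k\<le>n. \<omega> k = a k) \<and> \<omega> (Suc n) = j}" for a :: "nat \<Rightarrow> 'm"
  have finA: "finite A" unfolding A_def by (intro finite_PiE) auto
  have C[measurable]: "C a \<in> sets M" for a
  proof -
    have "{\<omega> \<in> space M. \<forall>k\<le>n. \<omega> k = a k} \<in> sets M" by measurable
    then show ?thesis by (simp add: C_def)
  qed
  have D[measurable]: "D a \<in> sets M" for a
  proof -
    have "{\<omega> \<in> space M. (\<forall>k\<le>n. \<omega> k = a k) \<and> \<omega> (Suc n) = j} \<in> sets M" by measurable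
    then show ?thesis by (simp add: D_def)
  qed
  \<comment> \<open>The members of \<open>A\<close> are extensional, so each path lies in
    \<open>C a\<close> for exactly one \<open>a \<in> A\<close>, its own restriction.\<close>
  have single: "(\<Sum>a\<in>A. H a * indicator (C a) \<omega>) = H (restrict \<omega> {..n})" for H :: "_ \<Rightarrow> real" and \<omega>
  proof -
    have "\<omega> \<in> C a \<longleftrightarrow> a = restrict \<omega> {..n}" if "a \<in> A" for a
      using that by (auto simp: A_def C_def fun_eq_iff PiE_def extensional_def restrict_def)
    then have "(\<Sum>a\<in>A. H a * indicator (C a) \<omega>) = (\<Sum>a\<in>A. if a = restrict \<omega> {..n} then H a else 0)"
      by (intro sum.cong) (auto simp: indicator_def)
    also have "\<dots> = H (restrict \<omega> {..n})" using finA by (simp add: A_def)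
    finally show ?thesis .
  qed
  have Fr: "F (restrict \<omega> {..n}) = F \<omega>" for \<omega> by (rule F) simp
  have Fsum: "F = (\<lambda>\<omega>. \<Sum>a\<in>A. F a * indicator (C a) \<omega>)"
    by (simp add: single Fr)
  show "integrable M F"
    by (subst Fsum) (auto intro!: Bochner_Integration.integrable_sum integrable_mult_right simp: less_top[symmetric])
  let ?H = "\<lambda>a \<omega>. F a * (indicator (D a) \<omega> - P (Suc n) $ a n $ j * indicator (C a) \<omega>)"
  have "F \<omega> * (indicator {j} (\<omega> (Suc n)) - P (Suc n) $ \<omega> n $ j) = (\<Sum>a\<in>A. ?H a \<omega>)" for \<omega>
  proof -
    have "F a * (indicator {j} (\<omega> (Suc n)) - P (Suc n) $ a n $ j) * indicator (C a) \<omega> = ?H a \<omega>" for a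
      by (auto simp: C_def D_def indicator_def)
    then have "(\<Sum>a\<in>A. ?H a \<omega>) =
        (\<Sum>a\<in>A. (F a * (indicator {j} (\<omega> (Suc n)) - P (Suc n) $ a n $ j)) * indicator (C a) \<omega>)"
      by (simp only:)
    also have "\<dots> = F \<omega> * (indicator {j} (\<omega> (Suc n)) - P (Suc n) $ \<omega> n $ j)"
      by (subst single) (simp add: Fr)
    finally show ?thesis by simp
  qed
  then have "expectation (\<lambda>\<omega>. F \<omega> * (indicator {j} (\<omega> (Suc n)) - P (Suc n) $ \<omega> n $ j)) =
      expectation (\<lambda>\<omega>. \<Sum>a\<in>A. ?H a \<omega>)" by simp
  also have "\<dots> = (\<Sum>a\<in>A. expectation (?H a))"
    by (rule Bochner_Integration.integral_sum) (auto intro!: integrable_mult_right integrable_diff simp: less_top[symmetric])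
  also have "\<dots> = (\<Sum>a\<in>A. F a * (prob (D a) - P (Suc n) $ a n $ j * prob (C a)))"
    by (intro sum.cong refl) (subst integral_mult_right_zero, subst Bochner_Integration.integral_diff, auto simp: less_top[symmetric])
  also have "\<dots> = 0"
    using prob_cylinder_Suc[of n _ j] by (intro sum.neutral) (simp add: C_def D_def mult.commute)
  finally show "expectation (\<lambda>\<omega>. F \<omega> * (indicator {j} (\<omega> (Suc n)) - P (Suc n) $ \<omega> n $ j)) = 0" .
qed

text \<open>Martingale differences are orthogonal, and given the past the \<open>k\<close>th one is a centred Bernoulli
  variable, whence the variances \<open>p (1 - p)\<close>.\<close>

lemma expectation_martingale_square:
  "expectation (\<lambda>\<omega>. (\<Sum>k<n. c k * (indicator {j} (\<omega> (Suc k)) - P (Suc k) $ \<omega> k $ j))\<^sup>2) =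
   (\<Sum>k<n. (c k)\<^sup>2 * expectation (\<lambda>\<omega>. P (Suc k) $ \<omega> k $ j * (1 - P (Suc k) $ \<omega> k $ j)))"
proof (induction n)
  case 0
  show ?case by simp
next
  case (Suc n)
  define S where "S \<omega> = (\<Sum>k<n. c k * (indicator {j} (\<omega> (Suc k)) - P (Suc k) $ \<omega> k $ j))"
    for \<omega> :: "nat \<Rightarrow> 'm"
  define p where "p \<omega> = P (Suc n) $ \<omega> n $ j" for \<omega> :: "nat \<Rightarrow> 'm"
  define X where "X \<omega> = indicator {j} (\<omega> (Suc n)) - p \<omega>" for \<omega> :: "nat \<Rightarrow> 'm"
  have S: "S \<omega> = S \<omega>'" if "\<And>k. k \<le> n \<Longrightarrow> \<omega> k = \<omega>' k" for \<omega> \<omega>'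
    using that by (simp add: S_def)
  have p: "p \<omega> = p \<omega>'" if "\<And>k. k \<le> n \<Longrightarrow> \<omega> k = \<omega>' k" for \<omega> \<omega>'
    using that by (simp add: p_def)
  have X: "X \<omega> = X \<omega>'" if "\<And>k. k \<le> Suc n \<Longrightarrow> \<omega> k = \<omega>' k" for \<omega> \<omega>'
    using that by (simp add: X_def p_def)
  have S': "S \<omega> = S \<omega>'" if "\<And>k. k \<le> Suc n \<Longrightarrow> \<omega> k = \<omega>' k" for \<omega> \<omega>'
    using that by (intro S) simp
  have p': "p \<omega> = p \<omega>'" if "\<And>k. k \<le> Suc n \<Longrightarrow> \<omega> k = \<omega>' k" for \<omega> \<omega>'
    using that by (intro p) simp
  have 1: "expectation (\<lambda>\<omega>. 2 * c n * S \<omega> * X \<omega>) = 0"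
    unfolding X_def p_def by (rule expectation_history_increment) (metis S)
  have 2: "expectation (\<lambda>\<omega>. (c n)\<^sup>2 * (1 - 2 * p \<omega>) * X \<omega>) = 0"
    unfolding X_def unfolding p_def[symmetric]
    using expectation_history_increment[of n "\<lambda>\<omega>. (c n)\<^sup>2 * (1 - 2 * p \<omega>)" j] p
    by (simp add: p_def)
  \<comment> \<open>An indicator equals its own square, so
    \<open>X\<^sup>2 = (1 - 2p) X + p (1 - p)\<close>. The cross term and the term with
    \<open>1 - 2p\<close> are a history times the increment \<open>X\<close>, and vanish in mean by
    facts 1 and 2.\<close>
  have "(S \<omega> + c n * X \<omega>)\<^sup>2 = (S \<omega>)\<^sup>2 + (2 * c n * S \<omega> * X \<omega> +
      ((c n)\<^sup>2 * (1 - 2 * p \<omega>) * X \<omega> + (c n)\<^sup>2 * (p \<omega> * (1 - p \<omega>))))" for \<omega>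
    by (cases "\<omega> (Suc n) = j") (simp_all add: X_def power2_eq_square algebra_simps)
  then have "expectation (\<lambda>\<omega>. (S \<omega> + c n * X \<omega>)\<^sup>2) =
      expectation (\<lambda>\<omega>. (S \<omega>)\<^sup>2 + (2 * c n * S \<omega> * X \<omega> +
      ((c n)\<^sup>2 * (1 - 2 * p \<omega>) * X \<omega> + (c n)\<^sup>2 * (p \<omega> * (1 - p \<omega>)))))" by simp
  also have "\<dots> = expectation (\<lambda>\<omega>. (S \<omega>)\<^sup>2) + (expectation (\<lambda>\<omega>. 2 * c n * S \<omega> * X \<omega>) +
      (expectation (\<lambda>\<omega>. (c n)\<^sup>2 * (1 - 2 * p \<omega>) * X \<omega>) +
       expectation (\<lambda>\<omega>. (c n)\<^sup>2 * (p \<omega> * (1 - p \<omega>)))))"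
  proof -
    have "integrable M (\<lambda>\<omega>. (S \<omega>)\<^sup>2)" "integrable M (\<lambda>\<omega>. 2 * c n * S \<omega> * X \<omega>)"
      "integrable M (\<lambda>\<omega>. (c n)\<^sup>2 * (1 - 2 * p \<omega>) * X \<omega>)"
      "integrable M (\<lambda>\<omega>. (c n)\<^sup>2 * (p \<omega> * (1 - p \<omega>)))"
      by (rule integrable_history[of "Suc n"]; metis S' X p')+
    then show ?thesis by simp
  qed
  also have "\<dots> = expectation (\<lambda>\<omega>. (S \<omega>)\<^sup>2) + (c n)\<^sup>2 * expectation (\<lambda>\<omega>. p \<omega> * (1 - p \<omega>))"
    using 1 2 by simp
  finally show ?case
    using Suc by (simp add: S_def X_def p_def)
qed

text \<open>The jump indicator is the sum over \<open>j\<close> of the indicator of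
  \<open>\<omega> n \<noteq> j\<close> times that of \<open>\<omega> (Suc n) = j\<close>. In each
  term the first factor is a history, so \<open>expectation_history_increment\<close> replaces the
  second by its transition probability.\<close>

lemma prob_jump:
  "prob {\<omega>. \<omega> (Suc n) \<noteq> \<omega> n} = expectation (\<lambda>\<omega>. \<Sum>j\<in>UNIV - {\<omega> n}. P (Suc n) $ \<omega> n $ j)"
proof -
  have m[measurable]: "{\<omega>. \<omega> (Suc n) \<noteq> \<omega> n} \<in> sets M"
  proof -
    have "{\<omega> \<in> space M. \<omega> (Suc n) \<noteq> \<omega> n} \<in> sets M" by measurable
    then show ?thesis by simp
  qed
  let ?F = "\<lambda>(j::'m) \<omega>. indicator (- {j}) (\<omega> n) :: real"
  have "(indicator {\<omega>. \<omega> (Suc n) \<noteq> \<omega> n} \<omega> :: real) = (\<Sum>j\<in>UNIV. ?F j \<omega> * indicator {j} (\<omega> (Suc n)))" for \<omega>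
  proof -
    have "(\<Sum>j\<in>UNIV. ?F j \<omega> * indicator {j} (\<omega> (Suc n))) =
        (\<Sum>j\<in>UNIV. if j = \<omega> (Suc n) then ?F j \<omega> else 0)"
      by (intro sum.cong) (auto simp: indicator_def)
    also have "\<dots> = ?F (\<omega> (Suc n)) \<omega>" by simp
    finally show ?thesis by (auto simp: indicator_def)
  qed
  moreover have "(\<Sum>j\<in>UNIV - {\<omega> n}. P (Suc n) $ \<omega> n $ j) = (\<Sum>j\<in>UNIV. ?F j \<omega> * P (Suc n) $ \<omega> n $ j)" for \<omega>
    by (intro sum.mono_neutral_cong_left) (auto simp: indicator_def)
  ultimately have "(indicator {\<omega>. \<omega> (Suc n) \<noteq> \<omega> n} \<omega> :: real) - (\<Sum>j\<in>UNIV - {\<omega> n}. P (Suc n) $ \<omega> n $ j) =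
      (\<Sum>j\<in>UNIV. ?F j \<omega> * (indicator {j} (\<omega> (Suc n)) - P (Suc n) $ \<omega> n $ j))" for \<omega>
    by (simp add: sum_subtractf right_diff_distrib)
  then have "expectation (\<lambda>\<omega>. indicator {\<omega>. \<omega> (Suc n) \<noteq> \<omega> n} \<omega> - (\<Sum>j\<in>UNIV - {\<omega> n}. P (Suc n) $ \<omega> n $ j)) =
     expectation (\<lambda>\<omega>. \<Sum>j\<in>UNIV. ?F j \<omega> * (indicator {j} (\<omega> (Suc n)) - P (Suc n) $ \<omega> n $ j))"
    by simp
  also have "\<dots> = (\<Sum>j\<in>UNIV. expectation (\<lambda>\<omega>. ?F j \<omega> * (indicator {j} (\<omega> (Suc n)) - P (Suc n) $ \<omega> n $ j)))"
    by (rule Bochner_Integration.integral_sum, rule integrable_history[of "Suc n"]) simp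
  also have "\<dots> = 0"
    by (intro sum.neutral ballI expectation_history_increment) simp
  finally have "expectation (\<lambda>\<omega>. indicator {\<omega>. \<omega> (Suc n) \<noteq> \<omega> n} \<omega> - (\<Sum>j\<in>UNIV - {\<omega> n}. P (Suc n) $ \<omega> n $ j)) = 0" .
  moreover have "integrable M (\<lambda>\<omega>. \<Sum>j\<in>UNIV - {\<omega> n}. P (Suc n) $ \<omega> n $ j)"
    by (rule integrable_history[of n]) simp
  ultimately show ?thesis
    by (subst (asm) Bochner_Integration.integral_diff) (auto simp: less_top[symmetric])
qed

end

section \<open>Scaled transition entries, summation by parts, occupation vectors\<close>

lemma transition_scaled:
  fixes G :: "real ^ 'm::finite ^ 'm"
  shows "real (Suc k) powr \<zeta> * (transition G \<zeta> (Suc k) $ i $ j - indicator {j} i) =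
   (if Suc k \<le> threshold G \<zeta> then 0 else G $ i $ j)"
proof -
  have "(mat 1 :: real ^ 'm ^ 'm) $ i $ j = indicator {j} i" by (simp add: mat_def indicator_def)
  moreover have "real (Suc k) powr \<zeta> \<noteq> 0" by simp
  ultimately show ?thesis by (simp add: transition_def del: of_nat_Suc)
qed

lemma generator_entry_le_norm: "\<bar>G $ i $ j\<bar> \<le> norm (G :: real ^ 'n::finite ^ 'm::finite)"
  using component_le_norm_cart[of "G $ i" j] Finite_Cartesian_Product.norm_nth_le[of G i] by linarith

lemma transition_scaled_bound:
  fixes G :: "real ^ 'm::finite ^ 'm"
  shows "real (Suc k) powr \<zeta> * \<bar>transition G \<zeta> (Suc k) $ i $ j - indicator {j} i\<bar> \<le> norm G"
proof -
  have "real (Suc k) powr \<zeta> * \<bar>transition G \<zeta> (Suc k) $ i $ j - indicator {j} i\<bar> =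
      \<bar>real (Suc k) powr \<zeta> * (transition G \<zeta> (Suc k) $ i $ j - indicator {j} i)\<bar>"
    by (simp add: abs_mult)
  then show ?thesis
    unfolding transition_scaled using generator_entry_le_norm[of G i j] by auto
qed

lemma transition_le_1:
  fixes G :: "real ^ 'm::finite ^ 'm"
  assumes "G \<in> generators" "\<zeta> > 0"
  shows "transition G \<zeta> n $ i $ j \<le> 1"
  using member_le_sum[of j UNIV "\<lambda>j. transition G \<zeta> n $ i $ j"]
    row_sum_transition[OF assms(1), of \<zeta> n i] transition_nonneg[OF assms] by simp

text \<open>Abel summation gives \<open>c n * b n\<close> minus \<open>c 0 * b 0\<close> plus the
  sum of \<open>(c (Suc k) - c k) * b k\<close>. The subtracted quantity lies between 0 and
  \<open>c n\<close>, which is the two-sided bound proved by induction.\<close>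

lemma abs_sum_by_parts_le:
  fixes b c :: "nat \<Rightarrow> real"
  assumes b: "\<And>k. 0 \<le> b k" "\<And>k. b k \<le> 1" and c: "\<And>k. 0 \<le> c k" "\<And>k. c k \<le> c (Suc k)"
  shows "\<bar>\<Sum>k<n. c (Suc k) * (b (Suc k) - b k)\<bar> \<le> c n"
proof -
  have "c n * b n - c n \<le> (\<Sum>k<n. c (Suc k) * (b (Suc k) - b k)) \<and>
      (\<Sum>k<n. c (Suc k) * (b (Suc k) - b k)) \<le> c n * b n"
  proof (induction n)
    case 0
    then show ?case using b[of 0] c(1)[of 0] mult_left_le[of "b 0" "c 0"] by simp
  next
    case (Suc n)
    have "(c (Suc n) - c n) * b n \<ge> 0" "(c (Suc n) - c n) * (1 - b n) \<ge> 0"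
      using b[of n] c(2)[of n] by simp_all
    with Suc show ?case by (simp add: algebra_simps)
  qed
  moreover have "0 \<le> c n * b n" "c n * b n \<le> c n"
    using b[of n] c(1)[of n] mult_left_le[of "b n" "c n"] by simp_all
  ultimately show ?thesis by linarith
qed

lemma occupation_vector_matrix_mult:
  fixes G :: "real ^ 'm::finite ^ 'm"
  shows "(occupation n \<omega> v* G) $ j = (1 / real n) * (\<Sum>k=1..n. G $ \<omega> k $ j)"
proof -
  have "(\<Sum>i\<in>UNIV. G $ i $ j * (\<Sum>k=1..n. indicator {i} (\<omega> k))) =
      (\<Sum>k=1..n. \<Sum>i\<in>UNIV. G $ i $ j * indicator {i} (\<omega> k))"
    by (subst sum.swap) (simp add: sum_distrib_left)
  also have "\<dots> = (\<Sum>k=1..n. \<Sum>i\<in>UNIV. if i = \<omega> k then G $ i $ j else 0)"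
    by (intro sum.cong refl) (auto simp: indicator_def)
  finally have "(\<Sum>i\<in>UNIV. G $ i $ j * (\<Sum>k=1..n. indicator {i} (\<omega> k))) = (\<Sum>k=1..n. G $ \<omega> k $ j)"
    by simp
  then show ?thesis
    by (simp add: vector_matrix_mult_def occupation_def sum_divide_distrib[symmetric] mult.commute)
qed

lemma sum_occupation:
  fixes \<omega> :: "nat \<Rightarrow> 'm::finite"
  assumes "n \<ge> 1"
  shows "(\<Sum>i\<in>UNIV. occupation n \<omega> $ i) = (1 :: real)"
proof -
  have "(\<Sum>i\<in>UNIV. \<Sum>k=1..n. indicator {i} (\<omega> k)) = (\<Sum>k=1..n. \<Sum>i\<in>UNIV. if i = \<omega> k then 1 else (0::real))"
    by (subst sum.swap) (intro sum.cong refl, auto simp: indicator_def)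
  then show ?thesis
    using assms by (simp add: occupation_def sum_divide_distrib[symmetric])
qed

lemma occupation_cong:
  "(\<And>k. k \<le> n \<Longrightarrow> \<omega> k = \<omega>' k) \<Longrightarrow> occupation n \<omega> = occupation n \<omega>'"
  by (simp add: occupation_def)

section \<open>Second moment of the distance to the stationary vector\<close>

locale cooling_chain = markov_chain \<pi> "transition G \<zeta>" M
  for G :: "real ^ 'm::finite ^ 'm" and \<zeta> and \<pi> and M +
  assumes generator: "G \<in> generators" and zeta_pos: "\<zeta> > 0"
begin

text \<open>\<open>occupation n\<close> depends on finitely many coordinates, each with finitely
  many values, so \<open>g\<close> may be any function.\<close>

lemma integrable_occupation: "integrable M (\<lambda>\<omega>. g (occupation n \<omega>))" for g :: "_ \<Rightarrow> real"
proof (rule integrable_history[of n])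
  fix \<omega> \<omega>' :: "nat \<Rightarrow> 'm" assume "\<And>k. k \<le> n \<Longrightarrow> \<omega> k = \<omega>' k"
  then have "occupation n \<omega> = occupation n \<omega>'" by (rule occupation_cong)
  then show "g (occupation n \<omega>) = g (occupation n \<omega>')" by simp
qed

text \<open>The martingale part of \<open>n\<close> times \<open>occupation n \<omega> v* G\<close>.
  The weights cancel the factor \<open>(k+1)\<close> to the power \<open>-\<zeta>\<close> by which
  the transition matrix differs from the identity.\<close>

definition noise :: "nat \<Rightarrow> 'm \<Rightarrow> (nat \<Rightarrow> 'm) \<Rightarrow> real" where
  "noise n j \<omega> = (\<Sum>k<n. real (Suc k) powr \<zeta> *
     (indicator {j} (\<omega> (Suc k)) - transition G \<zeta> (Suc k) $ \<omega> k $ j))"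

lemma noise_cong: "(\<And>k. k \<le> n \<Longrightarrow> \<omega> k = \<omega>' k) \<Longrightarrow> noise n j \<omega> = noise n j \<omega>'"
  by (simp add: noise_def)

text \<open>Of the two weights in the variance of a step, one is absorbed by the small jump
  probability, leaving \<open>norm G\<close>, and the other is at most
  \<open>real n powr \<zeta>\<close>. There are \<open>n\<close> steps.\<close>

lemma expectation_noise_square_le:
  "expectation (\<lambda>\<omega>. (noise n j \<omega>)\<^sup>2) \<le> norm G * real n powr (1 + \<zeta>)"
proof -
  let ?c = "\<lambda>k. real (Suc k) powr \<zeta>" and ?p = "\<lambda>k \<omega>. transition G \<zeta> (Suc k) $ \<omega> k $ j"
  have "expectation (\<lambda>\<omega>. (noise n j \<omega>)\<^sup>2) =
      (\<Sum>k<n. (?c k)\<^sup>2 * expectation (\<lambda>\<omega>. ?p k \<omega> * (1 - ?p k \<omega>)))"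
    unfolding noise_def by (rule expectation_martingale_square)
  also have "\<dots> \<le> (\<Sum>k<n. real n powr \<zeta> * norm G)"
  proof (rule sum_mono)
    fix k assume k: "k \<in> {..<n}"
    have "?c k * (?p k \<omega> * (1 - ?p k \<omega>)) \<le> norm G" for \<omega>
    proof -
      have p: "0 \<le> ?p k \<omega>" "?p k \<omega> \<le> 1"
        using transition_nonneg[OF generator zeta_pos] transition_le_1[OF generator zeta_pos] by auto
      \<comment> \<open>The right-hand side is \<open>1 - p\<close> if the chain is at
        \<open>j\<close> and \<open>p\<close> otherwise; either one dominates
        \<open>p (1 - p)\<close>.\<close>
      then have "?p k \<omega> * (1 - ?p k \<omega>) \<le> \<bar>?p k \<omega> - indicator {j} (\<omega> k)\<bar>"
        using mult_left_le[of "1 - ?p k \<omega>" "?p k \<omega>"] mult_left_le_one_le[of "1 - ?p k \<omega>" "?p k \<omega>"]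
        by (auto simp: indicator_def)
      then have "?c k * (?p k \<omega> * (1 - ?p k \<omega>)) \<le> ?c k * \<bar>?p k \<omega> - indicator {j} (\<omega> k)\<bar>"
        by (intro mult_left_mono) auto
      then show ?thesis using transition_scaled_bound[of k \<zeta> G "\<omega> k" j] by linarith
    qed
    then have "expectation (\<lambda>\<omega>. ?c k * (?p k \<omega> * (1 - ?p k \<omega>))) \<le> norm G"
      by (intro integral_le_const integrable_history[of k]) auto
    then have "?c k * expectation (\<lambda>\<omega>. ?c k * (?p k \<omega> * (1 - ?p k \<omega>))) \<le> real n powr \<zeta> * norm G"
      using k zeta_pos transition_nonneg[OF generator zeta_pos] transition_le_1[OF generator zeta_pos]
      by (intro mult_mono powr_mono2 Bochner_Integration.integral_nonneg) auto
    then show "(?c k)\<^sup>2 * expectation (\<lambda>\<omega>. ?p k \<omega> * (1 - ?p k \<omega>)) \<le> real n powr \<zeta> * norm G"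
      by (simp add: power2_eq_square mult.assoc)
  qed
  also have "\<dots> = norm G * real n powr (1 + \<zeta>)"
    by (simp add: powr_add)
  finally show ?thesis .
qed

text \<open>Past the initial stretch where \<open>P\<^sub>n = I\<close> one has \<open>n\<^sup>\<zeta> (P\<^sub>n - I) = G\<close>, so up to noise \<open>G(X\<^sub>k, j)\<close> is
  \<open>(k+1)\<^sup>\<zeta>\<close> times an increment of the indicator of \<open>j\<close>; summation by parts applies.\<close>

lemma abs_sum_generator_le:
  "\<bar>\<Sum>k=1..n. G $ \<omega> k $ j\<bar> \<le>
   real n powr \<zeta> + \<bar>noise n j \<omega>\<bar> + (2 + real (threshold G \<zeta>)) * norm G"
proof -
  let ?N = "threshold G \<zeta>"
  let ?A = "\<Sum>k<n. real (Suc k) powr \<zeta> * (indicator {j} (\<omega> (Suc k)) - indicator {j} (\<omega> k))"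
  let ?E = "\<Sum>k<n. if Suc k \<le> ?N then G $ \<omega> k $ j else 0"
  have "noise n j \<omega> = (\<Sum>k<n. real (Suc k) powr \<zeta> * (indicator {j} (\<omega> (Suc k)) - indicator {j} (\<omega> k))
      - (if Suc k \<le> ?N then 0 else G $ \<omega> k $ j))"
    unfolding noise_def transition_scaled[symmetric] by (intro sum.cong refl) (simp add: algebra_simps)
  also have "\<dots> = (\<Sum>k<n. real (Suc k) powr \<zeta> * (indicator {j} (\<omega> (Suc k)) - indicator {j} (\<omega> k))
      + (if Suc k \<le> ?N then G $ \<omega> k $ j else 0) - G $ \<omega> k $ j)"
    by (intro sum.cong) auto
  also have "\<dots> = ?A + ?E - (\<Sum>k<n. G $ \<omega> k $ j)"
    by (simp add: sum.distrib sum_subtractf)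
  finally have noise: "(\<Sum>k<n. G $ \<omega> k $ j) = ?A + ?E - noise n j \<omega>" by simp
  \<comment> \<open>Occupation counts times 1 to \<open>n\<close>, the noise runs over times 0 to
    \<open>n - 1\<close>. The two boundary terms account for the 2 in the final constant.\<close>
  have "(\<Sum>k=1..n. G $ \<omega> k $ j) = (\<Sum>k\<le>n. G $ \<omega> k $ j) - G $ \<omega> 0 $ j"
    by (simp add: atMost_atLeast0 sum.atLeast_Suc_atMost)
  also have "(\<Sum>k\<le>n. G $ \<omega> k $ j) = (\<Sum>k<n. G $ \<omega> k $ j) + G $ \<omega> n $ j"
    by (simp add: lessThan_Suc_atMost[symmetric])
  finally have eq: "(\<Sum>k=1..n. G $ \<omega> k $ j) = ?A + ?E - noise n j \<omega> + G $ \<omega> n $ j - G $ \<omega> 0 $ j"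
    using noise by simp
  have A: "\<bar>?A\<bar> \<le> real n powr \<zeta>"
    by (rule abs_sum_by_parts_le[where c="\<lambda>k. real k powr \<zeta>"])
      (use zeta_pos in \<open>auto intro!: powr_mono2\<close>)
  \<comment> \<open>\<open>?E\<close> collects the steps with identity transition, where the scaled
    increment has mean 0 instead of a row entry of \<open>G\<close>; there are at most
    \<open>?N\<close> of them.\<close>
  have "\<bar>?E\<bar> \<le> (\<Sum>k<n. if k < ?N then norm G else 0)"
    by (rule order_trans[OF sum_abs]) (auto intro!: sum_mono generator_entry_le_norm)
  also have "\<dots> = (\<Sum>k\<in>{..<n} \<inter> {..<?N}. norm G)"
    by (simp add: sum.If_cases lessThan_def Int_def)
  also have "\<dots> \<le> (\<Sum>k<?N. norm G)"
    by (intro sum_mono2) auto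
  finally have E: "\<bar>?E\<bar> \<le> real ?N * norm G" by simp
  have "(2 + real ?N) * norm G = norm G + norm G + real ?N * norm G" by (simp add: algebra_simps)
  then show ?thesis
    using eq A E generator_entry_le_norm[of G "\<omega> n" j] generator_entry_le_norm[of G "\<omega> 0" j]
    by linarith
qed

text \<open>The lower bound for \<open>z \<mapsto> z v* G\<close> reduces the distance to the row
  sums of \<open>abs_sum_generator_le\<close>, whose squares are integrated using the noise
  variance.\<close>

lemma expectation_dist_square_le:
  assumes "\<zeta> < 1"
  obtains C where "\<And>n. n \<ge> 1 \<Longrightarrow>
    expectation (\<lambda>\<omega>. (dist (occupation n \<omega>) (stationary_vector G))\<^sup>2) \<le> C * real n powr (\<zeta> - 1)"
proof -
  define K where "K = (2 + real (threshold G \<zeta>)) * norm G"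
  obtain e where e: "e > 0"
    "\<And>z. (\<Sum>i\<in>UNIV. z $ i) = 1 \<Longrightarrow> e * dist z (stationary_vector G) \<le> norm (z v* G)"
    using dist_stationary_vector_le[OF generator] by blast
  show thesis
  proof
    fix n :: nat assume n: "n \<ge> 1"
    let ?a = "real n powr \<zeta>"
    \<comment> \<open>The difference of the two sides is the sum of the squares of the three
      pairwise differences.\<close>
    have sq: "(x + y + z)\<^sup>2 \<le> 3 * (x\<^sup>2 + y\<^sup>2 + z\<^sup>2)" for x y z :: real
      using sum_power2_ge_zero[of "x - y" "y - z"] zero_le_power2[of "x - z"]
      by (simp add: power2_eq_square algebra_simps)
    have "(dist (occupation n \<omega>) (stationary_vector G))\<^sup>2 \<le>
        (\<Sum>j\<in>UNIV. 3 * (?a\<^sup>2 + (noise n j \<omega>)\<^sup>2 + K\<^sup>2) / (real n)\<^sup>2) / e\<^sup>2" for \<omega>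
    proof -
      have "(e * dist (occupation n \<omega>) (stationary_vector G))\<^sup>2 \<le> (norm (occupation n \<omega> v* G))\<^sup>2"
        using e n by (intro power_mono e(2) sum_occupation) auto
      also have "\<dots> = (\<Sum>j\<in>UNIV. ((1 / real n) * (\<Sum>k=1..n. G $ \<omega> k $ j))\<^sup>2)"
        unfolding power2_norm_eq_inner inner_vec_def occupation_vector_matrix_mult
        by (simp add: power2_eq_square)
      also have "\<dots> \<le> (\<Sum>j\<in>UNIV. 3 * (?a\<^sup>2 + (noise n j \<omega>)\<^sup>2 + K\<^sup>2) / (real n)\<^sup>2)"
      proof (rule sum_mono)
        fix j
        have "(\<Sum>k=1..n. G $ \<omega> k $ j)\<^sup>2 \<le> (?a + \<bar>noise n j \<omega>\<bar> + K)\<^sup>2"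
          using abs_sum_generator_le[where n=n and \<omega>=\<omega> and j=j] unfolding K_def[symmetric]
          by (intro power2_le_iff_abs_le[THEN iffD2]) auto
        also have "\<dots> \<le> 3 * (?a\<^sup>2 + (noise n j \<omega>)\<^sup>2 + K\<^sup>2)"
          using sq[of ?a "\<bar>noise n j \<omega>\<bar>" K] by simp
        finally show "((1 / real n) * (\<Sum>k=1..n. G $ \<omega> k $ j))\<^sup>2 \<le>
            3 * (?a\<^sup>2 + (noise n j \<omega>)\<^sup>2 + K\<^sup>2) / (real n)\<^sup>2"
          by (simp add: power_mult_distrib power_divide divide_right_mono)
      qed
      finally show ?thesis
        unfolding power_mult_distrib using e(1) by (subst pos_le_divide_eq) (simp_all only: mult.commute zero_less_power)
    qed
    then have "expectation (\<lambda>\<omega>. (dist (occupation n \<omega>) (stationary_vector G))\<^sup>2) \<le>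
        expectation (\<lambda>\<omega>. (\<Sum>j\<in>UNIV. 3 * (?a\<^sup>2 + (noise n j \<omega>)\<^sup>2 + K\<^sup>2) / (real n)\<^sup>2) / e\<^sup>2)"
    proof (intro integral_mono integrable_history[of n])
      show "(dist (occupation n \<omega>) (stationary_vector G))\<^sup>2 = (dist (occupation n \<omega>') (stationary_vector G))\<^sup>2"
        if "\<And>k. k \<le> n \<Longrightarrow> \<omega> k = \<omega>' k" for \<omega> \<omega>' :: "nat \<Rightarrow> 'm"
        by (simp only: occupation_cong[OF that])
      show "(\<Sum>j\<in>UNIV. 3 * (?a\<^sup>2 + (noise n j \<omega>)\<^sup>2 + K\<^sup>2) / (real n)\<^sup>2) / e\<^sup>2 =
          (\<Sum>j\<in>UNIV. 3 * (?a\<^sup>2 + (noise n j \<omega>')\<^sup>2 + K\<^sup>2) / (real n)\<^sup>2) / e\<^sup>2"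
        if "\<And>k. k \<le> n \<Longrightarrow> \<omega> k = \<omega>' k" for \<omega> \<omega>' :: "nat \<Rightarrow> 'm"
        by (simp only: noise_cong[OF that])
    qed auto
    also have "\<dots> = (\<Sum>j\<in>UNIV. 3 * (?a\<^sup>2 + expectation (\<lambda>\<omega>. (noise n j \<omega>)\<^sup>2) + K\<^sup>2) / (real n)\<^sup>2) / e\<^sup>2"
    proof -
      have "integrable M (\<lambda>\<omega>. (noise n j \<omega>)\<^sup>2)" for j
        by (rule integrable_history[of n], metis noise_cong)
      then show ?thesis
        by (simp add: prob_space[unfolded space_M])
    qed
    \<comment> \<open>All three terms are of order at most \<open>real n powr (1 + \<zeta>)\<close>:
      the noise by its variance bound, \<open>?a\<^sup>2\<close> because
      \<open>2 * \<zeta> \<le> 1 + \<zeta>\<close>, the constant because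
      \<open>n \<ge> 1\<close>.\<close>
    also have "\<dots> \<le> (\<Sum>j\<in>(UNIV::'m set). 3 * ((1 + norm G + K\<^sup>2) * real n powr (1 + \<zeta>)) / (real n)\<^sup>2) / e\<^sup>2"
    proof -
      have "?a\<^sup>2 = real n powr (2 * \<zeta>)" using n by (simp add: powr_power)
      also have "\<dots> \<le> real n powr (1 + \<zeta>)" using n assms by (intro powr_mono) auto
      finally have 1: "?a\<^sup>2 \<le> real n powr (1 + \<zeta>)" .
      have "1 \<le> real n powr (1 + \<zeta>)" using n zeta_pos by (intro ge_one_powr_ge_zero) auto
      then have 2: "K\<^sup>2 \<le> K\<^sup>2 * real n powr (1 + \<zeta>)" by (simp add: mult_le_cancel_left1)
      have "?a\<^sup>2 + expectation (\<lambda>\<omega>. (noise n j \<omega>)\<^sup>2) + K\<^sup>2 \<le> (1 + norm G + K\<^sup>2) * real n powr (1 + \<zeta>)" for j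
        using 1 2 expectation_noise_square_le[of n j] unfolding distrib_right by linarith
      then show ?thesis
        by (intro divide_right_mono sum_mono mult_left_mono) auto
    qed
    also have "\<dots> = real CARD('m) * 3 * (1 + norm G + K\<^sup>2) / e\<^sup>2 * (real n powr (1 + \<zeta>) / (real n)\<^sup>2)"
      by (simp add: mult_ac)
    also have "real n powr (1 + \<zeta>) / (real n)\<^sup>2 = real n powr (\<zeta> - 1)"
    proof -
      have "\<zeta> - 1 = (1 + \<zeta>) - 2" by simp
      then show ?thesis using n by (simp only: powr_diff) (simp add: powr_numeral)
    qed
    finally show "expectation (\<lambda>\<omega>. (dist (occupation n \<omega>) (stationary_vector G))\<^sup>2) \<le>
        (real CARD('m) * 3 * (1 + norm G + K\<^sup>2) / e\<^sup>2) * real n powr (\<zeta> - 1)" .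
  qed
qed

section \<open>Convergence in probability and almost surely\<close>

lemma prob_dist_occupation_le:
  assumes "\<zeta> < 1"
  obtains C where "\<And>n \<epsilon>. n \<ge> 1 \<Longrightarrow> \<epsilon> > 0 \<Longrightarrow>
    prob {\<omega>. dist (occupation n \<omega>) (stationary_vector G) > \<epsilon>} \<le> C / \<epsilon>\<^sup>2 * real n powr (\<zeta> - 1)"
proof -
  obtain C where C: "\<And>n. n \<ge> 1 \<Longrightarrow>
    expectation (\<lambda>\<omega>. (dist (occupation n \<omega>) (stationary_vector G))\<^sup>2) \<le> C * real n powr (\<zeta> - 1)"
    using expectation_dist_square_le[OF assms] by blast
  show thesis
  proof
    fix n :: nat and \<epsilon> :: real assume n: "n \<ge> 1" and \<epsilon>: "\<epsilon> > 0"
    let ?d = "\<lambda>\<omega>. dist (occupation n \<omega>) (stationary_vector G)"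
    have int: "integrable M ?d" "integrable M (\<lambda>\<omega>. (?d \<omega>)\<^sup>2)"
      using integrable_occupation[of "\<lambda>z. dist z (stationary_vector G)" n]
        integrable_occupation[of "\<lambda>z. (dist z (stationary_vector G))\<^sup>2" n] by this
    note [measurable] = borel_measurable_integrable[OF int(1)]
    have "{\<omega> \<in> space M. \<bar>?d \<omega>\<bar> \<ge> \<epsilon>} \<in> sets M" by measurable
    then have "prob {\<omega>. ?d \<omega> > \<epsilon>} \<le> prob {\<omega> \<in> space M. \<bar>?d \<omega>\<bar> \<ge> \<epsilon>}"
      by (intro finite_measure_mono) auto
    also have "\<dots> \<le> expectation (\<lambda>\<omega>. (?d \<omega>)\<^sup>2) / \<epsilon>\<^sup>2"
      using int(2) \<epsilon> by (intro second_moment_method) auto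
    also have "\<dots> \<le> C * real n powr (\<zeta> - 1) / \<epsilon>\<^sup>2"
      using C[OF n] by (intro divide_right_mono) auto
    finally show "prob {\<omega>. ?d \<omega> > \<epsilon>} \<le> C / \<epsilon>\<^sup>2 * real n powr (\<zeta> - 1)" by simp
  qed
qed

lemma occupation_tendsto_in_prob:
  assumes "\<zeta> < 1"
  shows "tendsto_in_prob M occupation (\<lambda>_. stationary_vector G)"
  unfolding tendsto_in_prob_def
proof (intro allI impI)
  fix \<epsilon> :: real assume \<epsilon>: "\<epsilon> > 0"
  obtain C where C: "\<And>n \<epsilon>. n \<ge> 1 \<Longrightarrow> \<epsilon> > 0 \<Longrightarrow>
    prob {\<omega>. dist (occupation n \<omega>) (stationary_vector G) > \<epsilon>} \<le> C / \<epsilon>\<^sup>2 * real n powr (\<zeta> - 1)"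
    using prob_dist_occupation_le[OF assms] by blast
  have "(\<lambda>n. real n powr (\<zeta> - 1)) \<longlonglongrightarrow> 0"
    using assms by (intro tendsto_neg_powr filterlim_real_sequentially) auto
  from tendsto_mult_right_zero[OF this, of "C / \<epsilon>\<^sup>2"]
  have lim: "(\<lambda>n. C / \<epsilon>\<^sup>2 * real n powr (\<zeta> - 1)) \<longlonglongrightarrow> 0" by simp
  show "(\<lambda>n. \<P>(\<omega> in M. dist (occupation n \<omega>) (stationary_vector G) > \<epsilon>)) \<longlonglongrightarrow> 0"
  proof (rule tendsto_sandwich[OF _ _ tendsto_const lim])
    show "\<forall>\<^sub>F n in sequentially. \<P>(\<omega> in M. dist (occupation n \<omega>) (stationary_vector G) > \<epsilon>)
        \<le> C / \<epsilon>\<^sup>2 * real n powr (\<zeta> - 1)"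
      using eventually_ge_at_top[of 1] by eventually_elim (use C \<epsilon> in simp)
  qed simp
qed

lemma AE_occupation_tendsto:
  assumes "\<zeta> < 1/2"
  shows "AE \<omega> in M. (\<lambda>n. occupation n \<omega>) \<longlonglongrightarrow> stationary_vector G"
proof -
  let ?d = "\<lambda>n \<omega>. dist (occupation n \<omega>) (stationary_vector G)"
  have "\<zeta> < 1" using assms by simp
  then obtain C where C: "\<And>n \<epsilon>. n \<ge> 1 \<Longrightarrow> \<epsilon> > 0 \<Longrightarrow>
    prob {\<omega>. ?d n \<omega> > \<epsilon>} \<le> C / \<epsilon>\<^sup>2 * real n powr (\<zeta> - 1)"
    using prob_dist_occupation_le by blast
  have d[measurable]: "?d n \<in> borel_measurable M" for n
    by (rule borel_measurable_integrable, rule integrable_occupation)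
  have io: "AE \<omega> in M. \<forall>\<^sub>F j in sequentially. \<omega> \<in> space M - {\<omega> \<in> space M. ?d (j\<^sup>2) \<omega> > \<epsilon>}" if \<epsilon>: "\<epsilon> > 0" for \<epsilon>
  proof (rule borel_cantelli_AE1)
    show "{\<omega> \<in> space M. ?d (j\<^sup>2) \<omega> > \<epsilon>} \<in> sets M" for j by measurable
    \<comment> \<open>Sampling at squares doubles the exponent, and
      \<open>2 * (\<zeta> - 1) < -1\<close> is the condition \<open>\<zeta> < 1/2\<close>.\<close>
    have "summable (\<lambda>j. C / \<epsilon>\<^sup>2 * real j powr (2 * (\<zeta> - 1)))"
      using assms by (intro summable_mult) (simp add: summable_real_powr_iff)
    moreover have "\<exists>N. \<forall>j\<ge>N. norm (prob {\<omega> \<in> space M. ?d (j\<^sup>2) \<omega> > \<epsilon>}) \<le> C / \<epsilon>\<^sup>2 * real j powr (2 * (\<zeta> - 1))"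
    proof (intro exI[of _ 1] allI impI)
      fix j :: nat assume j: "j \<ge> 1"
      have "real (j\<^sup>2) powr (\<zeta> - 1) = real j powr (2 * (\<zeta> - 1))"
        using powr_powr[of "real j" 2 "\<zeta> - 1"] j by simp
      then show "norm (prob {\<omega> \<in> space M. ?d (j\<^sup>2) \<omega> > \<epsilon>}) \<le> C / \<epsilon>\<^sup>2 * real j powr (2 * (\<zeta> - 1))"
        using C[of "j\<^sup>2" \<epsilon>] j \<epsilon> by simp
    qed
    ultimately show "summable (\<lambda>j. prob {\<omega> \<in> space M. ?d (j\<^sup>2) \<omega> > \<epsilon>})"
      by (rule summable_comparison_test[rotated])
  qed (simp add: less_top[symmetric])
  \<comment> \<open>The exceptional null set depends on the tolerance; restricting to tolerances
    \<open>1 / (m + 1)\<close> leaves a countable union of null sets.\<close>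
  have "AE \<omega> in M. \<forall>\<^sub>F j in sequentially. ?d (j\<^sup>2) \<omega> \<le> inverse (real (Suc m))" for m
  proof -
    have "inverse (real (Suc m)) > 0" by simp
    from io[OF this] show ?thesis
      by eventually_elim (auto elim!: eventually_mono)
  qed
  then have "AE \<omega> in M. \<forall>m::nat. \<forall>\<^sub>F j in sequentially. ?d (j\<^sup>2) \<omega> \<le> inverse (real (Suc m))"
    unfolding AE_all_countable by blast
  then show ?thesis
  proof (rule AE_mp, intro AE_I2 impI)
    fix \<omega> assume *: "\<forall>m::nat. \<forall>\<^sub>F j in sequentially. ?d (j\<^sup>2) \<omega> \<le> inverse (real (Suc m))"
    have sq: "(\<lambda>j. occupation (j\<^sup>2) \<omega>) \<longlonglongrightarrow> stationary_vector G"
    proof (rule tendstoI)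
      fix e :: real assume "e > 0"
      then obtain m where "inverse (real (Suc m)) < e" using reals_Archimedean by blast
      then show "\<forall>\<^sub>F j in sequentially. ?d (j\<^sup>2) \<omega> < e"
        using *[rule_format, of m] by (auto elim!: eventually_mono)
    qed
    \<comment> \<open>Coordinatewise, since each unnormalised count is nondecreasing in
      \<open>n\<close>.\<close>
    show "(\<lambda>n. occupation n \<omega>) \<longlonglongrightarrow> stationary_vector G"
    proof (rule vec_tendstoI)
      fix i
      let ?S = "\<lambda>n. \<Sum>k=1..n. indicator {i} (\<omega> k) :: real"
      have "(\<lambda>n. ?S n / real n) \<longlonglongrightarrow> stationary_vector G $ i"
      proof (rule average_tendsto_along_squares)
        show "mono ?S" by (intro monoI sum_mono2) auto
        show "?S n \<ge> 0" for n by (intro sum_nonneg) auto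
        show "(\<lambda>j. ?S (j\<^sup>2) / real (j\<^sup>2)) \<longlonglongrightarrow> stationary_vector G $ i"
          using tendsto_vec_nth[OF sq, of i] by (simp add: occupation_def)
      qed
      then show "(\<lambda>n. occupation n \<omega> $ i) \<longlonglongrightarrow> stationary_vector G $ i"
        by (simp add: occupation_def)
    qed
  qed
qed

section \<open>Freezing and weak convergence for \<zeta> > 1\<close>

text \<open>Off-diagonal entries of the transition matrix are at most
  \<open>norm G * real (Suc n) powr - \<zeta>\<close>, so jump probabilities are summable and almost
  every path jumps only finitely often.\<close>

lemma AE_eventually_const:
  assumes "\<zeta> > 1"
  shows "AE \<omega> in M. \<exists>i. \<forall>\<^sub>F n in sequentially. \<omega> n = i"
proof -
  have "AE \<omega> in M. \<forall>\<^sub>F n in sequentially. \<omega> \<in> space M - {\<omega> \<in> space M. \<omega> (Suc n) \<noteq> \<omega> n}"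
  proof (rule borel_cantelli_AE1)
    show "{\<omega> \<in> space M. \<omega> (Suc n) \<noteq> \<omega> n} \<in> sets M" for n by measurable
    have "summable (\<lambda>n. real n powr - \<zeta>)"
      using assms by (simp add: summable_real_powr_iff)
    then have "summable (\<lambda>n. real CARD('m) * norm G * real (Suc n) powr - \<zeta>)"
      by (intro summable_mult) (subst summable_Suc_iff)
    moreover have "norm (prob {\<omega> \<in> space M. \<omega> (Suc n) \<noteq> \<omega> n}) \<le> real CARD('m) * norm G * real (Suc n) powr - \<zeta>" for n
    proof -
      have *: "transition G \<zeta> (Suc n) $ i $ j \<le> norm G * real (Suc n) powr - \<zeta>" if "j \<noteq> i" for i j
      proof -
        have "real (Suc n) powr \<zeta> * transition G \<zeta> (Suc n) $ i $ j \<le> norm G"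
          using transition_scaled_bound[of n \<zeta> G i j] that
            transition_nonneg[OF generator zeta_pos, of "Suc n" i j] by simp
        then show ?thesis by (simp add: powr_minus field_simps del: of_nat_Suc)
      qed
      have "(\<Sum>j\<in>UNIV - {i}. transition G \<zeta> (Suc n) $ i $ j) \<le> real CARD('m) * norm G * real (Suc n) powr - \<zeta>" for i
      proof -
        have "(\<Sum>j\<in>UNIV - {i}. transition G \<zeta> (Suc n) $ i $ j) \<le> (\<Sum>j\<in>UNIV - {i}. norm G * real (Suc n) powr - \<zeta>)"
          by (intro sum_mono *) auto
        also have "\<dots> \<le> (\<Sum>j\<in>(UNIV::'m set). norm G * real (Suc n) powr - \<zeta>)"
          by (intro sum_mono2) auto
        finally show ?thesis by (simp add: mult.assoc)
      qed
      then have "prob {\<omega>. \<omega> (Suc n) \<noteq> \<omega> n} \<le> real CARD('m) * norm G * real (Suc n) powr - \<zeta>"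
        unfolding prob_jump by (intro integral_le_const integrable_history[of n]) auto
      then show ?thesis by simp
    qed
    ultimately show "summable (\<lambda>n. prob {\<omega> \<in> space M. \<omega> (Suc n) \<noteq> \<omega> n})"
      by (rule summable_comparison_test'[where N=0])
  qed (simp add: less_top[symmetric])
  then show ?thesis
  proof (rule AE_mp, intro AE_I2 impI)
    fix \<omega> assume "\<forall>\<^sub>F n in sequentially. \<omega> \<in> space M - {\<omega> \<in> space M. \<omega> (Suc n) \<noteq> \<omega> n}"
    then obtain N where N: "\<And>n. n \<ge> N \<Longrightarrow> \<omega> (Suc n) = \<omega> n"
      by (auto simp: eventually_sequentially)
    have "\<omega> n = \<omega> N" if "n \<ge> N" for n
      using that by (induction n rule: dec_induct) (auto simp: N)
    then show "\<exists>i. \<forall>\<^sub>F n in sequentially. \<omega> n = i"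
      by (auto simp: eventually_sequentially)
  qed
qed

text \<open>Almost surely the path freezes in a random state \<open>X\<close>. By dominated
  convergence the law of \<open>X\<close> is the limit distribution of the chain. Averages of a
  frozen path tend to the vertex at \<open>X\<close>, and dominated convergence applies again. The
  equation for \<open>M\<close> links this to \<open>limit_distribution\<close>, which is defined
  through \<open>chain_law\<close>.\<close>

lemma occupation_weakly_converges:
  assumes "\<zeta> > 1" and M: "M = chain_law G \<zeta> \<pi>"
  shows "weakly_converges euclidean (\<lambda>n. distr M borel (occupation n))
    (vertex_mixture (limit_distribution G \<zeta> \<pi>))"
proof -
  \<comment> \<open>The value is unspecified on paths that are not eventually constant, a null set
    by \<open>AE_eventually_const\<close>. Measurability holds because there are countably many
    candidate states and at most one fits each path.\<close>
  define X where "X \<omega> = (THE i. \<forall>\<^sub>F n in sequentially. \<omega> n = i)" for \<omega> :: "nat \<Rightarrow> 'm"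
  have unique: "i = j" if "\<forall>\<^sub>F n in sequentially. \<omega> n = i" "\<forall>\<^sub>F n in sequentially. \<omega> n = j"
    for i j and \<omega> :: "nat \<Rightarrow> 'm"
    using eventually_happens[OF eventually_conj[OF that]] by auto
  have X[measurable]: "X \<in> measurable M (count_space UNIV)"
    unfolding X_def
  proof (rule measurable_THE[where I=UNIV])
    show "Measurable.pred M (\<lambda>\<omega>. \<forall>\<^sub>F n in sequentially. \<omega> n = i)" for i
      unfolding eventually_sequentially by measurable
  qed (rule countableI_type UNIV_I | (rule unique, assumption, assumption))+
  have AE_X: "AE \<omega> in M. \<forall>\<^sub>F n in sequentially. \<omega> n = X \<omega>"
    using AE_eventually_const[OF assms(1)]
  proof eventually_elim
    case (elim \<omega>)
    then obtain i where i: "\<forall>\<^sub>F n in sequentially. \<omega> n = i" by blast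
    have "X \<omega> = i"
      unfolding X_def by (rule the_equality[where P="\<lambda>i. \<forall>\<^sub>F n in sequentially. \<omega> n = i", OF i unique[OF _ i]])
    with i show ?case by simp
  qed
  have coord[measurable]: "(\<lambda>\<omega>. \<omega> n) \<in> measurable M (count_space UNIV)" for n by measurable
  have occ[measurable]: "occupation n \<in> measurable M borel" for n
    unfolding borel_measurable_euclidean_space[of "occupation n"]
  proof
    fix b :: "real ^ 'm" assume "b \<in> Basis"
    show "(\<lambda>\<omega>. occupation n \<omega> \<bullet> b) \<in> borel_measurable M"
      by (rule borel_measurable_integrable, rule integrable_occupation)
  qed
  \<comment> \<open>The law of \<open>X\<close> repackaged as a \<open>pmf\<close>, the type in
    which \<open>limit_distribution\<close> takes its value.\<close>
  define \<nu> where "\<nu> = Abs_pmf (distr M (count_space UNIV) X)"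
  have \<nu>: "measure_pmf \<nu> = distr M (count_space UNIV) X"
    unfolding \<nu>_def
  proof (rule Abs_pmf_inverse, intro CollectI conjI)
    show P: "prob_space (distr M (count_space UNIV) X)" by (rule prob_space_distr) (rule X)
    show "sets (distr M (count_space UNIV) X) = UNIV" by simp
    interpret D: prob_space "distr M (count_space UNIV) X" by (rule P)
    show "AE x in distr M (count_space UNIV) X. measure (distr M (count_space UNIV) X) {x} \<noteq> 0"
      by (subst D.AE_support_countable) (auto intro!: exI[of _ UNIV] simp: countable_finite)
  qed
  have "weakly_converges (discrete_topology UNIV)
      (\<lambda>n. distr M (count_space UNIV) (\<lambda>\<omega>. \<omega> n)) (measure_pmf \<nu>)"
    unfolding weakly_converges_def \<nu>
  proof (intro allI impI)
    fix f :: "'m \<Rightarrow> real" assume "continuous_map (discrete_topology UNIV) euclideanreal f \<and> bounded (f ` topspace (discrete_topology UNIV))"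
    then obtain B where B: "\<And>x. \<bar>f x\<bar> \<le> B" by (auto simp: bounded_iff)
    have "(\<lambda>n. \<integral>\<omega>. f (\<omega> n) \<partial>M) \<longlonglongrightarrow> (\<integral>\<omega>. f (X \<omega>) \<partial>M)"
    proof (rule integral_dominated_convergence[where w="\<lambda>_. B"])
      show "AE \<omega> in M. (\<lambda>n. f (\<omega> n)) \<longlonglongrightarrow> f (X \<omega>)"
        using AE_X by eventually_elim (auto intro!: tendsto_eventually elim!: eventually_mono)
    qed (auto simp: B)
    then show "(\<lambda>n. \<integral>x. f x \<partial>distr M (count_space UNIV) (\<lambda>\<omega>. \<omega> n)) \<longlonglongrightarrow> (\<integral>x. f x \<partial>distr M (count_space UNIV) X)"
      by (simp add: integral_distr)
  qed
  then have lim: "limit_distribution G \<zeta> \<pi> = \<nu>"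
    unfolding limit_distribution_def M[symmetric]
    by (intro the_equality) (auto intro: weakly_converges_discrete_unique)
  show ?thesis
    unfolding weakly_converges_def lim
  proof (intro allI impI)
    fix f :: "real ^ 'm \<Rightarrow> real"
    assume f: "continuous_map euclidean euclideanreal f \<and> bounded (f ` topspace euclidean)"
    then obtain B where B: "\<And>x. \<bar>f x\<bar> \<le> B" by (auto simp: bounded_iff)
    have cont: "continuous_on UNIV f" using f by simp
    then have [measurable]: "f \<in> borel_measurable borel" by (rule borel_measurable_continuous_onI)
    have "(\<lambda>n. \<integral>\<omega>. f (occupation n \<omega>) \<partial>M) \<longlonglongrightarrow> (\<integral>\<omega>. f (axis (X \<omega>) 1) \<partial>M)"
    proof (rule integral_dominated_convergence[where w="\<lambda>_. B"])
      show "AE \<omega> in M. (\<lambda>n. f (occupation n \<omega>)) \<longlonglongrightarrow> f (axis (X \<omega>) 1)"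
        using AE_X
      proof eventually_elim
        case (elim \<omega>)
        have "(\<lambda>n. occupation n \<omega>) \<longlonglongrightarrow> axis (X \<omega>) 1"
        proof (rule vec_tendstoI)
          fix i
          show "(\<lambda>n. occupation n \<omega> $ i) \<longlonglongrightarrow> axis (X \<omega>) 1 $ i"
            unfolding occupation_def vec_lambda_beta
            by (rule eventually_const_imp_average_tendsto)
              (use elim in \<open>auto elim!: eventually_mono simp: axis_def indicator_def\<close>)
        qed
        then show ?case
          using cont by (intro continuous_on_tendsto_compose[OF cont]) auto
      qed
    qed (auto simp: B)
    \<comment> \<open>The mixture is the image of the law of \<open>X\<close> under
      \<open>i \<mapsto> axis i 1\<close>, so its integrals are the limits just found.\<close>
    moreover have "vertex_mixture \<nu> = distr (measure_pmf \<nu>) borel (\<lambda>i. axis i 1)"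
      unfolding vertex_mixture_def by (rule bind_return_distr') auto
    ultimately show "(\<lambda>n. \<integral>x. f x \<partial>distr M borel (occupation n)) \<longlonglongrightarrow> (\<integral>x. f x \<partial>vertex_mixture \<nu>)"
      by (simp add: integral_distr \<nu>)
  qed
qed

end

theorem theorem1p2:
  fixes G :: "real ^ 'm ^ 'm" and \<pi> :: "'m::finite pmf" and \<zeta> :: real
  assumes "CARD('m) \<ge> 2"
    and "G \<in> generators"
  shows "(0 < \<zeta> \<and> \<zeta> < 1 \<longrightarrow>
            tendsto_in_prob (chain_law G \<zeta> \<pi>) occupation (\<lambda>_. stationary_vector G)) \<and>
         (0 < \<zeta> \<and> \<zeta> < 1/2 \<longrightarrow>
            (AE \<omega> in chain_law G \<zeta> \<pi>. (\<lambda>n. occupation n \<omega>) \<longlonglongrightarrow> stationary_vector G)) \<and>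
         (\<zeta> > 1 \<longrightarrow>
            weakly_converges euclidean
              (\<lambda>n. distr (chain_law G \<zeta> \<pi>) borel (occupation n))
              (vertex_mixture (limit_distribution G \<zeta> \<pi>)))"
proof -
  \<comment> \<open>For \<open>\<zeta> > 0\<close> the definite description \<open>chain_law\<close>
    does denote a law of the chain, so the locale can be instantiated with it.\<close>
  have chain: "cooling_chain G \<zeta> \<pi> (chain_law G \<zeta> \<pi>)" if "\<zeta> > 0"
    using assms(2) that
    by (simp add: cooling_chain_def cooling_chain_axioms_def markov_chain_def is_markov_law_chain_law)
  show ?thesis
  proof (intro conjI impI)
    assume "0 < \<zeta> \<and> \<zeta> < 1"
    then show "tendsto_in_prob (chain_law G \<zeta> \<pi>) occupation (\<lambda>_. stationary_vector G)"
      using cooling_chain.occupation_tendsto_in_prob[OF chain] by simp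
  next
    assume "0 < \<zeta> \<and> \<zeta> < 1/2"
    then show "AE \<omega> in chain_law G \<zeta> \<pi>. (\<lambda>n. occupation n \<omega>) \<longlonglongrightarrow> stationary_vector G"
      using cooling_chain.AE_occupation_tendsto[OF chain] by simp
  next
    assume "\<zeta> > 1"
    then show "weakly_converges euclidean (\<lambda>n. distr (chain_law G \<zeta> \<pi>) borel (occupation n))
        (vertex_mixture (limit_distribution G \<zeta> \<pi>))"
      using cooling_chain.occupation_weakly_converges[OF chain] by simp
  qed
qed

end
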